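(* Let $p\in(0,\infty)$, let $W\in A_{p,\infty}$ be a matrix weight on $\mathbb R^n$ with values in $M_m(\mathbb C)$, and let $\{A_Q\}_{\text{cube }Q}$ be a family of reducing operators of order $p$ for $W$. Let $d_1\in[\![d_{p,\infty}^{\mathrm{lower}}(W),\infty)$ and $d_2\in[\![d_{p,\infty}^{\mathrm{upper}}(W),\infty)$ (notation explained in the context). Then there exists a positive constant $C$ such that, for any cubes $Q,R\subset\mathbb R^n$, $$\left\|A_QA_R^{-1}\right\|^p\le C\max\left\{\left[\frac{\ell(R)}{\ell(Q)}\right]^{d_1},\left[\frac{\ell(Q)}{\ell(R)}\right]^{d_2}\right\}\left[1+\frac{|c_Q-c_R|}{\max\{\ell(Q),\ell(R)\}}\right]^{d_1+d_2}.$$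
   Context: Fix $m,n\in\mathbb N$. $M_m(\mathbb C)$ is the set of complex $m\times m$ matrices and $\|\cdot\|$ is the operator norm induced by the Euclidean norm $|\cdot|$ of $\mathbb C^m$. A cube in $\mathbb R^n$ has edges parallel to the coordinate axes and finite positive edge length (not necessarily open or closed); $c_Q$ and $\ell(Q)$ denote the center and edge length of the cube $Q$, and $\lambda Q$ is the cube with center $c_Q$ and edge length $\lambda\ell(Q)$. $\fint_E f:=\frac1{|E|}\int_E f$, $\log_+t:=\max\{0,\log t\}$. A matrix weight is a function $W:\mathbb R^n\to M_m(\mathbb C)$ such that $W(x)$ is nonnegative definite for every $x$, $W(x)$ is invertible for almost every $x$, and all entries of $W$ are locally integrable. Real powers $W^\alpha(x)$ are defined by the spectral theorem. Reducing operator: for a cube $Q$, a reducing operator $A_Q$ of order $p$ for $W$ is a positive definite matrix such that $|A_Q\vec z|\sim\left[\fint_Q|W^{1/p}(x)\vec z|^p\,dx\right]^{1/p}$ for all $\vec z\in\mathbb C^m$, with positive equivalence constants depending only on $m$ and $p$ (such operators exist). $A_{p,\infty}$: a matrix weight $W$ belongs to $A_{p,\infty}$ if, for every cube $Q$, $\log_+\left(\fint_Q\|W^{1/p}(x)W^{-1/p}(\cdot)\|^p\,dx\right)\in L^1(Q)$, and $[W]_{A_{p,\infty}}:=\sup_Q\exp\left(\fint_Q\log\left(\fint_Q\|W^{1/p}(x)W^{-1/p}(y)\|^p\,dx\right)dy\right)<\infty$. Dimensions: for $d\in\mathbb R$, $W$ has $A_{p,\infty}$-lower dimension $d$ if there is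 $C>0$ such that, for all cubes $Q\subset R$, $$\exp\left(\fint_R\log\left(\fint_Q\|W^{1/p}(x)W^{-1/p}(y)\|^p\,dx\right)dy\right)\le C\left[\frac{\ell(R)}{\ell(Q)}\right]^d;$$ $W$ has $A_{p,\infty}$-upper dimension $d$ if there is $C>0$ such that, for all $\lambda\in[1,\infty)$ and all cubes $Q$, $$\exp\left(\fint_Q\log\left(\fint_{\lambda Q}\|W^{1/p}(x)W^{-1/p}(y)\|^p\,dx\right)dy\right)\le C\lambda^d.$$ For $W\in A_{p,\infty}$, let $d_{p,\infty}^{\mathrm{lower}}(W):=\inf\{d\in[0,n):W\text{ has }A_{p,\infty}\text{-lower dimension }d\}$ and $d_{p,\infty}^{\mathrm{upper}}(W):=\inf\{d\in[0,\infty):W\text{ has }A_{p,\infty}\text{-upper dimension }d\}$ (both sets are nonempty). The interval $[\![d_{p,\infty}^{\mathrm{lower}}(W),\infty)$ is the closed-at-left interval $[d_{p,\infty}^{\mathrm{lower}}(W),\infty)$ if $d_{p,\infty}^{\mathrm{lower}}(W)$ is itself an $A_{p,\infty}$-lower dimension of $W$, and the open interval $(d_{p,\infty}^{\mathrm{lower}}(W),\infty)$ otherwise; $[\![d_{p,\infty}^{\mathrm{upper}}(W),\infty)$ is defined in the same way with upper dimensions. *)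

theory Defs
  imports "HOL-Analysis.Analysis"
begin

text \<open>Throughout, \<open>real ^ 'n\<close> is Euclidean \<open>n\<close>-space with \<open>n = CARD('n)\<close>, and \<open>complex ^ 'm ^ 'm\<close>
  is the space of complex \<open>m \<times> m\<close> matrices with \<open>m = CARD('m)\<close>.\<close>

section \<open>Complex matrices\<close>

definition conj_transpose :: "complex ^ 'm ^ 'm \<Rightarrow> complex ^ 'm ^ 'm" where
  "conj_transpose A = (\<chi> i j. cnj (A $ j $ i))"

definition unitary_mat :: "complex ^ 'm ^ 'm \<Rightarrow> bool" where
  "unitary_mat U \<longleftrightarrow> conj_transpose U ** U = mat 1 \<and> U ** conj_transpose U = mat 1"

definition herm_form :: "complex ^ 'm ^ 'm \<Rightarrow> complex ^ 'm \<Rightarrow> complex" where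
  "herm_form A z = (\<Sum>i\<in>UNIV. cnj (z $ i) * (A *v z) $ i)"

text \<open>Over the complex numbers, a matrix with real Hermitian form is automatically Hermitian.\<close>

definition nonneg_definite :: "complex ^ 'm ^ 'm \<Rightarrow> bool" where
  "nonneg_definite A \<longleftrightarrow> (\<forall>z. herm_form A z \<in> \<real> \<and> 0 \<le> Re (herm_form A z))"

definition pos_definite :: "complex ^ 'm ^ 'm \<Rightarrow> bool" where
  "pos_definite A \<longleftrightarrow> (\<forall>z. z \<noteq> 0 \<longrightarrow> herm_form A z \<in> \<real> \<and> 0 < Re (herm_form A z))"

definition op_norm :: "complex ^ 'm ^ 'm \<Rightarrow> real" where
  "op_norm A = onorm (\<lambda>z. A *v z)"

definition diag_mat :: "('m \<Rightarrow> real) \<Rightarrow> complex ^ 'm ^ 'm" where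
  "diag_mat d = (\<chi> i j. if i = j then complex_of_real (d i) else 0)"

text \<open>\<open>mat_powr_rel A \<alpha> B\<close>: \<open>B\<close> arises from a unitary diagonalisation of the nonnegative definite
  matrix \<open>A\<close> by raising the eigenvalues to the power \<open>\<alpha>\<close>. By the convention \<open>0 powr \<alpha> = 0\<close>,
  singular matrices also get negative powers; for matrix weights this concerns a null set only.\<close>

definition mat_powr_rel :: "complex ^ 'm ^ 'm \<Rightarrow> real \<Rightarrow> complex ^ 'm ^ 'm \<Rightarrow> bool" where
  "mat_powr_rel A \<alpha> B \<longleftrightarrow> (\<exists>U d. unitary_mat U \<and> (\<forall>i. 0 \<le> d i) \<and>
     A = U ** diag_mat d ** conj_transpose U \<and>
     B = U ** diag_mat (\<lambda>i. d i powr \<alpha>) ** conj_transpose U)"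

definition mat_powr :: "complex ^ 'm ^ 'm \<Rightarrow> real \<Rightarrow> complex ^ 'm ^ 'm" where
  "mat_powr A \<alpha> = (THE B. mat_powr_rel A \<alpha> B)"

lemma mat_mult_diag: "(S ** diag_mat d) $ i $ j = S $ i $ j * complex_of_real (d j)"
  by (simp add: matrix_matrix_mult_def diag_mat_def if_distrib[of "\<lambda>x. _ * x"] cong: if_cong)

lemma diag_mult_mat: "(diag_mat d ** S) $ i $ j = complex_of_real (d i) * S $ i $ j"
  by (simp add: matrix_matrix_mult_def diag_mat_def if_distrib[of "\<lambda>x. x * _"] cong: if_cong)

lemma mat_powr_rel_unique:
  assumes "mat_powr_rel A \<alpha> B" "mat_powr_rel A \<alpha> B'"
  shows "B = B'"
proof -
  obtain U d where U: "unitary_mat U" "A = U ** diag_mat d ** conj_transpose U"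
      "B = U ** diag_mat (\<lambda>i. d i powr \<alpha>) ** conj_transpose U"
    using assms(1) unfolding mat_powr_rel_def by blast
  obtain V e where V: "unitary_mat V" "A = V ** diag_mat e ** conj_transpose V"
      "B' = V ** diag_mat (\<lambda>i. e i powr \<alpha>) ** conj_transpose V"
    using assms(2) unfolding mat_powr_rel_def by blast
  note u = U(1)[unfolded unitary_mat_def] and v = V(1)[unfolded unitary_mat_def]
  define S where "S = conj_transpose V ** U"
  have l: "conj_transpose V ** (U ** D ** conj_transpose U) ** U = S ** D" for D
    unfolding S_def using u by (metis matrix_mul_assoc matrix_mul_rid)
  have r: "conj_transpose V ** (V ** D ** conj_transpose V) ** U = D ** S" for D
    unfolding S_def using v by (metis matrix_mul_assoc matrix_mul_lid)
  have "S ** diag_mat d = diag_mat e ** S"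
    using U(2) V(2) l r by metis
  hence "S $ i $ j * complex_of_real (d j) = complex_of_real (e i) * S $ i $ j" for i j
    by (metis mat_mult_diag diag_mult_mat)
  hence "S $ i $ j = 0 \<or> d j = e i" for i j
    by (metis mult.commute mult_cancel_left of_real_eq_iff)
  hence "S $ i $ j * complex_of_real (d j powr \<alpha>) = complex_of_real (e i powr \<alpha>) * S $ i $ j" for i j
    by (metis mult.commute mult_zero_left)
  hence "S ** diag_mat (\<lambda>i. d i powr \<alpha>) = diag_mat (\<lambda>i. e i powr \<alpha>) ** S"
    by (simp add: vec_eq_iff mat_mult_diag diag_mult_mat)
  hence "conj_transpose V ** B ** U = conj_transpose V ** B' ** U"
    unfolding U(3) V(3) l r .
  hence "V ** (conj_transpose V ** B ** U) ** conj_transpose U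
       = V ** (conj_transpose V ** B' ** U) ** conj_transpose U"
    by simp
  thus ?thesis
    using u v by (metis matrix_mul_assoc matrix_mul_lid matrix_mul_rid)
qed

lemma mat_powr_eqI: "mat_powr_rel A \<alpha> B \<Longrightarrow> mat_powr A \<alpha> = B"
  unfolding mat_powr_def using mat_powr_rel_unique by blast

section \<open>Cubes and averages\<close>

text \<open>A cube is a product of intervals of equal positive length; each of the intervals may
  or may not contain each of its endpoints.\<close>

definition cube_at :: "real ^ 'n \<Rightarrow> real \<Rightarrow> (real ^ 'n) set \<Rightarrow> bool" where
  "cube_at c l Q \<longleftrightarrow> 0 < l \<and> (\<exists>I.
     (\<forall>i. {c $ i - l / 2 <..< c $ i + l / 2} \<subseteq> I i \<and> I i \<subseteq> {c $ i - l / 2 .. c $ i + l / 2}) \<and>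
     Q = {x. \<forall>i. x $ i \<in> I i})"

definition is_cube :: "(real ^ 'n) set \<Rightarrow> bool" where
  "is_cube Q \<longleftrightarrow> (\<exists>c l. cube_at c l Q)"

definition cube_center :: "(real ^ 'n) set \<Rightarrow> real ^ 'n" where
  "cube_center Q = (THE c. \<exists>l. cube_at c l Q)"

definition edge_length :: "(real ^ 'n) set \<Rightarrow> real" where
  "edge_length Q = (THE l. \<exists>c. cube_at c l Q)"

definition dilate :: "real \<Rightarrow> (real ^ 'n) set \<Rightarrow> (real ^ 'n) set" where
  "dilate s Q = (\<lambda>x. cube_center Q + s *\<^sub>R (x - cube_center Q)) ` Q"

lemma cube_at_closure:
  assumes "cube_at c l Q"
  shows "closure Q = cbox (\<chi> i. c $ i - l / 2) (\<chi> i. c $ i + l / 2)"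
proof -
  from assms obtain I where l: "0 < l" and
    I: "\<And>i. {c $ i - l / 2 <..< c $ i + l / 2} \<subseteq> I i" "\<And>i. I i \<subseteq> {c $ i - l / 2 .. c $ i + l / 2}"
    and Q: "Q = {x. \<forall>i. x $ i \<in> I i}"
    unfolding cube_at_def by blast
  let ?a = "\<chi> i. c $ i - l / 2" and ?b = "\<chi> i. c $ i + l / 2"
  have 1: "box ?a ?b \<subseteq> Q"
    unfolding Q using I(1) by (fastforce simp: mem_box_cart)
  have 2: "Q \<subseteq> cbox ?a ?b"
    unfolding Q using I(2) by (fastforce simp: mem_box_cart)
  have "c \<in> box ?a ?b" using l by (simp add: mem_box_cart)
  hence "closure (box ?a ?b) = cbox ?a ?b" by (metis closure_box empty_iff)
  thus ?thesis using closure_mono[OF 1] closure_minimal[OF 2 closed_cbox] by auto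
qed

lemma cube_at_unique:
  assumes "cube_at c l Q" "cube_at c' l' Q"
  shows "c = c' \<and> l = l'"
proof -
  have l: "0 < l" using assms(1) by (simp add: cube_at_def)
  have "cbox (\<chi> i. c $ i - l / 2) (\<chi> i. c $ i + l / 2)
      = cbox (\<chi> i. c' $ i - l' / 2) (\<chi> i. c' $ i + l' / 2)"
    using assms by (metis cube_at_closure)
  moreover have "c \<in> cbox (\<chi> i. c $ i - l / 2) (\<chi> i. c $ i + l / 2)"
    using l by (simp add: mem_box_cart)
  ultimately have "(\<chi> i. c $ i - l / 2) = (\<chi> i. c' $ i - l' / 2)"
      "(\<chi> i. c $ i + l / 2) = (\<chi> i. c' $ i + l' / 2)"
    by (metis eq_cbox empty_iff)+
  hence a: "c $ i - l / 2 = c' $ i - l' / 2" and b: "c $ i + l / 2 = c' $ i + l' / 2" for i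
    by (metis vec_lambda_beta)+
  have "c $ i = c' $ i" "l = l'" for i using a[of i] b[of i] by argo+
  thus ?thesis by (simp add: vec_eq_iff)
qed

lemma
  assumes "cube_at c l Q"
  shows cube_center_eq: "cube_center Q = c" and edge_length_eq: "edge_length Q = l"
  unfolding cube_center_def edge_length_def using assms cube_at_unique by blast+

lemma dilate_cube_at:
  assumes "cube_at c l Q" "0 < s"
  shows "cube_at c (s * l) (dilate s Q)"
proof -
  from assms obtain I where l: "0 < l" and
    I: "\<And>i. {c $ i - l / 2 <..< c $ i + l / 2} \<subseteq> I i" "\<And>i. I i \<subseteq> {c $ i - l / 2 .. c $ i + l / 2}"
    and Q: "Q = {x. \<forall>i. x $ i \<in> I i}"
    unfolding cube_at_def by blast
  define J where "J i = {t. c $ i + (t - c $ i) / s \<in> I i}" for i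
  have "dilate s Q = {x. \<forall>i. x $ i \<in> J i}"
  proof (intro set_eqI iffI)
    fix y assume "y \<in> dilate s Q"
    then obtain x where "x \<in> Q" "y = c + s *\<^sub>R (x - c)"
      unfolding dilate_def cube_center_eq[OF assms(1)] by blast
    thus "y \<in> {x. \<forall>i. x $ i \<in> J i}"
      using \<open>0 < s\<close> by (simp add: J_def Q)
  next
    fix y assume y: "y \<in> {x. \<forall>i. x $ i \<in> J i}"
    have "y = c + s *\<^sub>R ((c + (1 / s) *\<^sub>R (y - c)) - c)" using \<open>0 < s\<close> by simp
    moreover have "c + (1 / s) *\<^sub>R (y - c) \<in> Q" using y by (simp add: Q J_def)
    ultimately show "y \<in> dilate s Q"
      unfolding dilate_def cube_center_eq[OF assms(1)] by (rule image_eqI)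
  qed
  moreover have "{c $ i - s * l / 2 <..< c $ i + s * l / 2} \<subseteq> J i" for i
  proof
    fix t assume t: "t \<in> {c $ i - s * l / 2 <..< c $ i + s * l / 2}"
    have "s * (- l / 2) < t - c $ i" "t - c $ i < s * (l / 2)" using t by simp_all
    hence "- l / 2 < (t - c $ i) / s" "(t - c $ i) / s < l / 2"
      using \<open>0 < s\<close> by (simp_all add: pos_less_divide_eq pos_divide_less_eq mult.commute)
    hence "c $ i + (t - c $ i) / s \<in> {c $ i - l / 2 <..< c $ i + l / 2}" by simp
    thus "t \<in> J i" using I(1)[of i] unfolding J_def by blast
  qed
  moreover have "J i \<subseteq> {c $ i - s * l / 2 .. c $ i + s * l / 2}" for i
  proof
    fix t assume "t \<in> J i"
    hence "c $ i + (t - c $ i) / s \<in> {c $ i - l / 2 .. c $ i + l / 2}"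
      using I(2)[of i] unfolding J_def by blast
    hence "- l / 2 \<le> (t - c $ i) / s" "(t - c $ i) / s \<le> l / 2" by simp_all
    hence "s * (- l / 2) \<le> t - c $ i" "t - c $ i \<le> s * (l / 2)"
      using \<open>0 < s\<close> by (simp_all add: pos_le_divide_eq pos_divide_le_eq mult.commute)
    thus "t \<in> {c $ i - s * l / 2 .. c $ i + s * l / 2}" by simp
  qed
  moreover have "0 < s * l" using l \<open>0 < s\<close> by simp
  ultimately show ?thesis
    unfolding cube_at_def by (intro conjI exI[of _ J] allI) auto
qed

definition avg :: "(real ^ 'n) set \<Rightarrow> (real ^ 'n \<Rightarrow> real) \<Rightarrow> real" where
  "avg E f = (LINT x:E|lebesgue. f x) / measure lebesgue E"

section \<open>Matrix weights and their dimensions\<close>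

definition matrix_weight :: "(real ^ 'n \<Rightarrow> complex ^ 'm ^ 'm) \<Rightarrow> bool" where
  "matrix_weight W \<longleftrightarrow>
     (\<forall>x. nonneg_definite (W x)) \<and>
     (AE x in lebesgue. invertible (W x)) \<and>
     (\<forall>i j K. compact K \<longrightarrow> set_integrable lebesgue K (\<lambda>x. W x $ i $ j))"

text \<open>The equivalence constants are uniform in the cube and the vector; \<open>m\<close>, \<open>p\<close> and \<open>W\<close> are
  fixed here.\<close>

definition reducing_operators ::
  "real \<Rightarrow> (real ^ 'n \<Rightarrow> complex ^ 'm ^ 'm) \<Rightarrow> ((real ^ 'n) set \<Rightarrow> complex ^ 'm ^ 'm) \<Rightarrow> bool" where
  "reducing_operators p W A \<longleftrightarrow> (\<exists>a b. 0 < a \<and> 0 < b \<and> (\<forall>Q. is_cube Q \<longrightarrow>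
     pos_definite (A Q) \<and>
     (\<forall>z. a * (avg Q (\<lambda>x. norm (mat_powr (W x) (1 / p) *v z) powr p)) powr (1 / p) \<le> norm (A Q *v z) \<and>
          norm (A Q *v z) \<le> b * (avg Q (\<lambda>x. norm (mat_powr (W x) (1 / p) *v z) powr p)) powr (1 / p))))"

definition inner_avg :: "real \<Rightarrow> (real ^ 'n \<Rightarrow> complex ^ 'm ^ 'm) \<Rightarrow> (real ^ 'n) set \<Rightarrow> real ^ 'n \<Rightarrow> real" where
  "inner_avg p W Q y = avg Q (\<lambda>x. op_norm (mat_powr (W x) (1 / p) ** mat_powr (W y) (- 1 / p)) powr p)"

text \<open>\<open>log_mean p W Q R\<close> averages in \<open>x\<close> over \<open>Q\<close> and then geometrically in \<open>y\<close> over \<open>R\<close>. For a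
  matrix weight the negative part of the logarithm is always integrable over \<open>R\<close>, and for members
  of the class \<open>Apinf\<close> below the positive part is integrable as well, so for these the Bochner
  integral is never used outside its domain.\<close>

definition log_mean ::
  "real \<Rightarrow> (real ^ 'n \<Rightarrow> complex ^ 'm ^ 'm) \<Rightarrow> (real ^ 'n) set \<Rightarrow> (real ^ 'n) set \<Rightarrow> real" where
  "log_mean p W Q R = exp (avg R (\<lambda>y. ln (inner_avg p W Q y)))"

definition Apinf_const :: "real \<Rightarrow> (real ^ 'n \<Rightarrow> complex ^ 'm ^ 'm) \<Rightarrow> ennreal" where
  "Apinf_const p W = (SUP Q\<in>{Q. is_cube Q}. ennreal (log_mean p W Q Q))"

definition Apinf :: "real \<Rightarrow> (real ^ 'n \<Rightarrow> complex ^ 'm ^ 'm) set" where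
  "Apinf p = {W. matrix_weight W \<and>
     (\<forall>Q. is_cube Q \<longrightarrow> set_integrable lebesgue Q (\<lambda>y. max 0 (ln (inner_avg p W Q y)))) \<and>
     Apinf_const p W < \<infinity>}"

definition has_lower_dim :: "real \<Rightarrow> (real ^ 'n \<Rightarrow> complex ^ 'm ^ 'm) \<Rightarrow> real \<Rightarrow> bool" where
  "has_lower_dim p W d \<longleftrightarrow> (\<exists>C>0. \<forall>Q R. is_cube Q \<and> is_cube R \<and> Q \<subseteq> R \<longrightarrow>
     log_mean p W Q R \<le> C * (edge_length R / edge_length Q) powr d)"

definition has_upper_dim :: "real \<Rightarrow> (real ^ 'n \<Rightarrow> complex ^ 'm ^ 'm) \<Rightarrow> real \<Rightarrow> bool" where
  "has_upper_dim p W d \<longleftrightarrow> (\<exists>C>0. \<forall>s\<ge>1. \<forall>Q. is_cube Q \<longrightarrow>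
     log_mean p W (dilate s Q) Q \<le> C * s powr d)"

definition lower_dim :: "real \<Rightarrow> (real ^ 'n \<Rightarrow> complex ^ 'm ^ 'm) \<Rightarrow> real" where
  "lower_dim p W = Inf {d. 0 \<le> d \<and> d < real CARD('n) \<and> has_lower_dim p W d}"

definition upper_dim :: "real \<Rightarrow> (real ^ 'n \<Rightarrow> complex ^ 'm ^ 'm) \<Rightarrow> real" where
  "upper_dim p W = Inf {d. 0 \<le> d \<and> has_upper_dim p W d}"

definition lower_dim_range :: "real \<Rightarrow> (real ^ 'n \<Rightarrow> complex ^ 'm ^ 'm) \<Rightarrow> real set" where
  "lower_dim_range p W =
     (if has_lower_dim p W (lower_dim p W) then {lower_dim p W ..} else {lower_dim p W <..})"

definition upper_dim_range :: "real \<Rightarrow> (real ^ 'n \<Rightarrow> complex ^ 'm ^ 'm) \<Rightarrow> real set" where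
  "upper_dim_range p W =
     (if has_upper_dim p W (upper_dim p W) then {upper_dim p W ..} else {upper_dim p W <..})"

end

theory Submission
  imports Defs
begin

text \<open>Write \<open>M = W\<^sup>-\<^sup>1\<^sup>/\<^sup>p\<close>, and let \<open>log_mean\<close> be the geometric mean in the definition of the two dimensions.
  For all cubes \<open>Q\<close>, \<open>R\<close>, averaging the logarithm of
  \<open>\<parallel>A Q (A R)\<^sup>-\<^sup>1\<parallel> \<le> \<parallel>A Q M(y)\<parallel> \<parallel>M(y)\<^sup>-\<^sup>1 (A R)\<^sup>-\<^sup>1\<parallel>\<close> over \<open>y \<in> R\<close> gives
  \<open>\<parallel>A Q (A R)\<^sup>-\<^sup>1\<parallel>\<^sup>p \<le> C log_mean p W Q R\<close>. Inserting a dilate \<open>S\<close> of \<open>R\<close> which contains \<open>Q\<close> and has edge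
  length comparable to \<open>max (\<ell>(Q), \<ell>(R)) + |c\<^sub>Q - c\<^sub>R|\<close>, the lower dimension bounds \<open>A Q (A S)\<^sup>-\<^sup>1\<close>, the upper
  dimension bounds \<open>A S (A R)\<^sup>-\<^sup>1\<close>, and the product of the two bounds is the claim.

  That a number above the infimum of the dimensions is itself a dimension requires that dimensions
  exist at all. For this, the scalar weights \<open>|W\<^sup>1\<^sup>/\<^sup>p z|\<^sup>p\<close> satisfy the exp-log condition for \<open>A\<^sub>\<infinity>\<close>, uniformly
  in \<open>z\<close>. By Jensen's inequality a subset occupying a fixed proportion of a cube then carries a fixed
  proportion of the mass. Applied to the half-size cubes inside a cube and to their complements, this
  gives doubling and reverse doubling; iteration yields power growth of the averages.\<close>

section \<open>Spectral theorem\<close>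

text \<open>The type class inner product of \<open>complex ^ 'm\<close> is only the real part of
  this one. The conjugate sits on the first argument to agree with \<open>herm_form\<close>.\<close>

definition cip :: "complex ^ 'm \<Rightarrow> complex ^ 'm \<Rightarrow> complex" where
  "cip x y = (\<Sum>i\<in>UNIV. cnj (x $ i) * y $ i)"

lemma herm_form_cip: "herm_form A z = cip z (A *v z)"
  by (simp add: herm_form_def cip_def)

lemma cip_simps:
  "cip (x + y) z = cip x z + cip y z" "cip x (y + z) = cip x y + cip x z"
  "cip (x - y) z = cip x z - cip y z" "cip x (y - z) = cip x y - cip x z"
  "cip (c *s x) y = cnj c * cip x y" "cip x (c *s y) = c * cip x y"
  by (simp_all add: cip_def algebra_simps sum.distrib sum_subtractf sum_distrib_left)

lemma cip_cnj: "cnj (cip x y) = cip y x"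
  by (simp add: cip_def mult.commute)

lemma cip_self: "cip x x = complex_of_real ((norm x)\<^sup>2)"
  by (simp add: cip_def norm_vec_def L2_set_def sum_nonneg complex_norm_square[symmetric] mult.commute
      del: of_real_power)

lemma continuous_on_cip [continuous_intros]:
  assumes "continuous_on S f" "continuous_on S g"
  shows "continuous_on S (\<lambda>x. cip (f x) (g x))"
  unfolding cip_def by (intro continuous_intros continuous_on_cnj assms)

text \<open>Polarisation: the imaginary part of the quadratic form vanishes at every vector. Its
  values at x + y and x + iy give the imaginary and the real part of the identity.\<close>

lemma nonneg_definite_self_adjoint:
  assumes "nonneg_definite A"
  shows "cip x (A *v y) = cip (A *v x) y"
proof -
  define q where "q z = Im (cip z (A *v z))" for z
  have q0: "q z = 0" for z
    using assms unfolding nonneg_definite_def herm_form_cip q_def by (simp add: complex_is_Real_iff)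
  let ?a = "cip x (A *v y)" and ?b = "cip y (A *v x)"
  have "q (x + y) = q x + q y + Im ?a + Im ?b"
    by (simp add: q_def cip_simps matrix_vector_right_distrib)
  moreover have "q (x + \<i> *s y) = q x + q y + Re ?a - Re ?b"
    by (simp add: q_def cip_simps matrix_vector_right_distrib vector_scalar_commute)
  ultimately have "?a = cnj ?b"
    by (simp add: q0 complex_eq_iff)
  thus ?thesis by (simp add: cip_cnj)
qed

text \<open>The conditions form a square homogeneous system, indexed by the coordinates themselves,
  whose row \<open>k\<close> is zero; hence it is singular.\<close>

lemma exists_orthogonal_vector:
  fixes u :: "'m \<Rightarrow> complex ^ 'm"
  assumes "k \<notin> S"
  obtains z where "z \<noteq> 0" "\<And>i. i \<in> S \<Longrightarrow> cip (u i) z = 0"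
proof -
  define M :: "complex^'m^'m" where "M = (\<chi> i j. if i \<in> S then cnj (u i $ j) else 0)"
  have "row k M = 0" using assms by (simp add: M_def row_def vec_eq_iff)
  hence "det M = 0" by (rule det_zero_row)
  hence "\<not> (\<exists>B. B ** M = mat 1)"
    by (metis invertible_det_nz invertible_left_inverse)
  then obtain z where z: "M *v z = 0" "z \<noteq> 0" using matrix_left_invertible_ker by blast
  have "cip (u i) z = 0" if "i \<in> S" for i
    using arg_cong[OF z(1), of "\<lambda>v. v $ i"] that by (simp add: M_def matrix_vector_mult_def cip_def)
  with z that show ?thesis by blast
qed

text \<open>This is the first-order condition at the minimum t = 0. It is applied to variations of
  the Rayleigh quotient.\<close>

lemma quadratic_nonneg_linear_zero:
  fixes a b :: real
  assumes "\<And>t. 0 \<le> t * a + t\<^sup>2 * b"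
  shows "a = 0"
proof (rule ccontr)
  assume a: "a \<noteq> 0"
  \<comment> \<open>Any positive \<open>c\<close> above \<open>b\<close> serves: at t = -a/c the
    quadratic with \<open>c\<close> in place of \<open>b\<close> is exactly 0, so the original one
    is negative.\<close>
  define c where "c = \<bar>b\<bar> + 1"
  have c: "c > 0" "b < c" unfolding c_def by linarith+
  have "0 \<le> (- a / c) * a + (- a / c)\<^sup>2 * b" by (rule assms)
  also have "\<dots> < (- a / c) * a + (- a / c)\<^sup>2 * c"
    using a c by (intro add_strict_left_mono mult_strict_left_mono) auto
  also have "\<dots> = 0" using c by (simp add: power2_eq_square)
  finally show False by simp
qed

text \<open>A maximiser of the Rayleigh quotient on the orthogonal complement of the eigenvectors found
  so far is a further eigenvector.\<close>

lemma next_eigenvector: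
  fixes u :: "'m \<Rightarrow> complex ^ 'm"
  assumes A: "nonneg_definite A" and k: "k \<notin> S"
    and eig: "\<And>i. i \<in> S \<Longrightarrow> A *v u i = complex_of_real (d i) *s u i"
  obtains v \<mu> where "norm v = 1" "\<And>i. i \<in> S \<Longrightarrow> cip (u i) v = 0" "0 \<le> \<mu>"
    "A *v v = complex_of_real \<mu> *s v"
proof -
  define V where "V = {z. \<forall>i\<in>S. cip (u i) z = 0}"
  define f where "f z = Re (cip z (A *v z))" for z
  have V_eq: "V = (\<Inter>i\<in>S. {z. cip (u i) z = 0})" by (auto simp: V_def)
  have "closed V" unfolding V_eq
    by (intro closed_INT ballI closed_Collect_eq continuous_intros)
  hence comp: "compact (sphere 0 1 \<inter> V)" by (intro compact_Int_closed) auto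
  obtain z where "z \<noteq> 0" "\<And>i. i \<in> S \<Longrightarrow> cip (u i) z = 0"
    using exists_orthogonal_vector[OF k, of u] by metis
  hence z: "z \<noteq> 0" "z \<in> V" by (simp_all add: V_def)
  have V_scale: "c *s x \<in> V" and V_add: "x + y \<in> V" if "x \<in> V" "y \<in> V" for c x y
    using that by (auto simp: V_def cip_simps)
  have scR: "r *\<^sub>R x = complex_of_real r *s x" for r and x :: "complex^'m"
    unfolding vec_eq_iff vector_scaleR_component vector_smult_component by (simp add: scaleR_conv_of_real)
  have "(1 / norm z) *\<^sub>R z \<in> V" unfolding scR using z(2) by (rule V_scale[OF z(2)])
  hence "(1 / norm z) *\<^sub>R z \<in> sphere 0 1 \<inter> V" using z(1) by simp
  hence ne: "sphere 0 1 \<inter> V \<noteq> {}" by blast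
  have "continuous_on (sphere 0 1 \<inter> V) f" unfolding f_def
    by (intro continuous_intros)
  then obtain v where v: "v \<in> sphere 0 1 \<inter> V" and max: "\<And>x. x \<in> sphere 0 1 \<inter> V \<Longrightarrow> f x \<le> f v"
    using continuous_attains_sup[OF comp ne] by blast
  define \<mu> where "\<mu> = f v"
  have mu0: "\<mu> \<ge> 0" using A unfolding \<mu>_def f_def nonneg_definite_def herm_form_cip by blast
  \<comment> \<open>\<open>B\<close> is self-adjoint, and its form \<open>g\<close> is nonnegative
    on \<open>V\<close> and zero at \<open>v\<close>. So \<open>v\<close> minimises \<open>g\<close>
    on \<open>V\<close>.\<close>
  define B where "B x = complex_of_real \<mu> *s x - A *v x" for x
  define g where "g x = Re (cip x (B x))" for x
  have fscale: "f (r *\<^sub>R x) = r\<^sup>2 * f x" for r x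
    by (simp add: f_def scR cip_simps vector_scalar_commute power2_eq_square)
  have g: "g x = \<mu> * (norm x)\<^sup>2 - f x" for x
    by (simp add: g_def B_def f_def cip_simps cip_self del: of_real_power)
  have gnn: "g x \<ge> 0" if "x \<in> V" for x
  proof (cases "x = 0")
    case True thus ?thesis by (simp add: g f_def cip_def)
  next
    case False
    have "(1 / norm x) *\<^sub>R x \<in> V" unfolding scR using that by (rule V_scale[OF that])
    hence "(1 / norm x) *\<^sub>R x \<in> sphere 0 1 \<inter> V" using False by simp
    hence "f ((1 / norm x) *\<^sub>R x) \<le> \<mu>" unfolding \<mu>_def by (rule max)
    thus ?thesis using False unfolding fscale g by (simp add: field_simps power2_eq_square)
  qed
  have gv: "g v = 0" using v by (simp add: g \<mu>_def)
  have Badj: "cip x (B y) = cip (B x) y" for x y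
    by (simp add: B_def cip_simps nonneg_definite_self_adjoint[OF A])
  have Blin: "B (x + complex_of_real t *s y) = B x + complex_of_real t *s B y" for x y t
    by (simp add: B_def matrix_vector_right_distrib vector_scalar_commute vec_eq_iff algebra_simps)
  have orth: "Re (cip w (B v)) = 0" if w: "w \<in> V" for w
  proof -
    \<comment> \<open>Varying the minimiser in the direction \<open>w\<close> makes the linear
      coefficient vanish.\<close>
    have "0 \<le> t * (2 * Re (cip w (B v))) + t\<^sup>2 * g w" for t
    proof -
      have "0 \<le> g (v + complex_of_real t *s w)" using gnn V_add V_scale w v by blast
      also have "\<dots> = g v + t * Re (cip v (B w)) + t * Re (cip w (B v)) + t\<^sup>2 * g w"
        by (simp add: g_def Blin cip_simps power2_eq_square algebra_simps)
      also have "Re (cip v (B w)) = Re (cip w (B v))"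
        by (simp add: Badj[of v w] cip_cnj[of w "B v", symmetric])
      finally show ?thesis by (simp add: gv)
    qed
    thus ?thesis using quadratic_nonneg_linear_zero by fastforce
  qed
  \<comment> \<open>\<open>B\<close> maps each \<open>u i\<close> to a multiple of itself, so
    \<open>B v\<close> stays in \<open>V\<close>. It may then serve as its own test vector in
    \<open>orth\<close>, which forces \<open>B v = 0\<close>.\<close>
  have "cip (u i) (B v) = 0" if "i \<in> S" for i
  proof -
    have "cip (u i) (B v) = cip (B (u i)) v" by (rule Badj)
    also have "\<dots> = (\<mu> - d i) * cip (u i) v"
      by (simp add: B_def eig[OF that] cip_simps algebra_simps)
    also have "\<dots> = 0" using v that by (simp add: V_def)
    finally show ?thesis .
  qed
  hence "B v \<in> V" by (simp add: V_def)
  hence "Re (cip (B v) (B v)) = 0" by (rule orth)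
  hence "B v = 0" by (simp add: cip_self del: of_real_power)
  hence "A *v v = complex_of_real \<mu> *s v" by (simp add: B_def)
  moreover have "norm v = 1" "\<And>i. i \<in> S \<Longrightarrow> cip (u i) v = 0" using v by (auto simp: V_def)
  ultimately show ?thesis using mu0 that by blast
qed

text \<open>Induction over subsets of the coordinate index type: while an index is missing, fewer
  vectors than the dimension have been found and \<open>next_eigenvector\<close> supplies another.
  The case \<open>S = UNIV\<close> gives a basis.\<close>

lemma exists_orthonormal_eigenvectors:
  fixes A :: "complex ^ 'm ^ 'm" and S :: "'m set"
  assumes A: "nonneg_definite A"
  shows "\<exists>u d. (\<forall>i\<in>S. \<forall>j\<in>S. cip (u i) (u j) = (if i = j then 1 else 0)) \<and>
    (\<forall>i\<in>S. 0 \<le> d i \<and> A *v u i = complex_of_real (d i) *s u i)"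
  using finite[of S]
proof (induction S rule: finite_induct)
  case empty thus ?case by simp
next
  case (insert k S)
  then obtain u d where u: "\<forall>i\<in>S. \<forall>j\<in>S. cip (u i) (u j) = (if i = j then 1 else 0)"
    "\<forall>i\<in>S. 0 \<le> d i \<and> A *v u i = complex_of_real (d i) *s u i" by blast
  have eig: "A *v u i = complex_of_real (d i) *s u i" if "i \<in> S" for i using u(2) that by blast
  from next_eigenvector[of A k S u d, OF A insert.hyps(2) eig] obtain v \<mu> where v: "norm v = 1"
    "\<And>i. i \<in> S \<Longrightarrow> cip (u i) v = 0" "0 \<le> \<mu>" "A *v v = complex_of_real \<mu> *s v" by metis
  have v': "cip v (u i) = 0" if "i \<in> S" for i using v(2)[OF that] cip_cnj[of "u i" v] by simp
  have "cip v v = 1" by (simp add: cip_self v)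
  hence "(\<forall>i\<in>insert k S. \<forall>j\<in>insert k S. cip ((u(k := v)) i) ((u(k := v)) j) = (if i = j then 1 else 0)) \<and>
    (\<forall>i\<in>insert k S. 0 \<le> (d(k := \<mu>)) i \<and> A *v (u(k := v)) i = complex_of_real ((d(k := \<mu>)) i) *s (u(k := v)) i)"
    using u v v' insert.hyps(2) by auto
  thus ?case by blast
qed

text \<open>This gives the definite description in \<open>mat_powr\<close> its existence part;
  uniqueness is \<open>mat_powr_rel_unique\<close>. The columns of \<open>U\<close> are the
  eigenvectors.\<close>

theorem nonneg_definite_diagonalisation:
  fixes A :: "complex ^ 'm ^ 'm"
  assumes A: "nonneg_definite A"
  obtains U d where "unitary_mat U" "\<And>i. 0 \<le> d i" "A = U ** diag_mat d ** conj_transpose U"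
proof -
  obtain u :: "'m \<Rightarrow> complex ^ 'm" and d where u: "\<And>i j. cip (u i) (u j) = (if i = j then 1 else 0)"
    and d: "\<And>i. 0 \<le> d i" "\<And>i. A *v u i = complex_of_real (d i) *s u i"
    using exists_orthonormal_eigenvectors[OF A, of UNIV] by (metis UNIV_I)
  define U :: "complex^'m^'m" where "U = (\<chi> i j. u j $ i)"
  have 1: "conj_transpose U ** U = mat 1"
    using u by (simp add: vec_eq_iff U_def conj_transpose_def matrix_matrix_mult_def mat_def cip_def)
  hence 2: "U ** conj_transpose U = mat 1" using matrix_left_right_inverse by blast
  have "(A ** U) $ i $ j = (U ** diag_mat d) $ i $ j" for i j
  proof -
    have "(A ** U) $ i $ j = (A *v u j) $ i" by (simp add: matrix_matrix_mult_def matrix_vector_mult_def U_def)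
    also have "\<dots> = (U ** diag_mat d) $ i $ j" by (simp add: d mat_mult_diag U_def)
    finally show ?thesis .
  qed
  hence "A ** U = U ** diag_mat d" by (simp add: vec_eq_iff)
  hence "A = U ** diag_mat d ** conj_transpose U"
    using 2 by (metis matrix_mul_assoc matrix_mul_rid)
  with 1 2 d that show ?thesis unfolding unitary_mat_def by blast
qed

section \<open>Functional calculus\<close>

text \<open>The entries depend linearly on the diagonal \<open>f\<close>, so pointwise limits of
  functions of the eigenvalues carry over to matrices.\<close>

lemma conj_diag_nth:
  "(U ** diag_mat f ** conj_transpose U) $ i $ j
    = (\<Sum>k\<in>UNIV. complex_of_real (f k) * (U $ i $ k * cnj (U $ j $ k)))"
proof -
  have "(U ** diag_mat f ** conj_transpose U) $ i $ j
      = (\<Sum>k\<in>UNIV. (U ** diag_mat f) $ i $ k * cnj (U $ j $ k))"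
    by (simp add: matrix_matrix_mult_def conj_transpose_def)
  thus ?thesis by (simp add: mat_mult_diag mult_ac)
qed

lemma diag_mat_mult: "diag_mat f ** diag_mat g = diag_mat (\<lambda>i. f i * g i)"
  unfolding vec_eq_iff by (simp add: mat_mult_diag) (simp add: diag_mat_def)

lemma diag_mat_one: "diag_mat (\<lambda>_. 1) = mat 1"
  by (simp add: diag_mat_def mat_def vec_eq_iff)

lemma conj_diag_mult:
  assumes "unitary_mat U"
  shows "(U ** diag_mat f ** conj_transpose U) ** (U ** diag_mat g ** conj_transpose U)
    = U ** diag_mat (\<lambda>i. f i * g i) ** conj_transpose U"
proof -
  have "(U ** diag_mat f ** conj_transpose U) ** (U ** diag_mat g ** conj_transpose U)
     = U ** diag_mat f ** (conj_transpose U ** U) ** diag_mat g ** conj_transpose U"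
    by (simp add: matrix_mul_assoc)
  also have "\<dots> = U ** (diag_mat f ** diag_mat g) ** conj_transpose U"
    using assms by (simp add: unitary_mat_def matrix_mul_assoc)
  finally show ?thesis by (simp add: diag_mat_mult)
qed

text \<open>A single \<open>U\<close> serves all exponents at once, so powers with different
  exponents can be multiplied inside one eigenbasis.\<close>

lemma mat_powr_diagonalisation:
  fixes A :: "complex ^ 'm ^ 'm"
  assumes "nonneg_definite A"
  obtains U d where "unitary_mat U" "\<And>i. 0 \<le> d i" "A = U ** diag_mat d ** conj_transpose U"
    "\<And>\<alpha>. mat_powr A \<alpha> = U ** diag_mat (\<lambda>i. d i powr \<alpha>) ** conj_transpose U"
proof -
  obtain U d where U: "unitary_mat U" "\<And>i. 0 \<le> d i" "A = U ** diag_mat d ** conj_transpose U"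
    using nonneg_definite_diagonalisation[OF assms] by blast
  have "mat_powr A \<alpha> = U ** diag_mat (\<lambda>i. d i powr \<alpha>) ** conj_transpose U" for \<alpha>
    by (rule mat_powr_eqI) (use U in \<open>auto simp: mat_powr_rel_def\<close>)
  with U that show ?thesis by blast
qed

lemma mat_powr_mult_uminus:
  fixes A :: "complex ^ 'm ^ 'm"
  assumes "nonneg_definite A" "invertible A"
  shows "mat_powr A \<alpha> ** mat_powr A (- \<alpha>) = mat 1"
proof -
  obtain U d where U: "unitary_mat U" "\<And>i. 0 \<le> d i" "A = U ** diag_mat d ** conj_transpose U"
    "\<And>\<alpha>. mat_powr A \<alpha> = U ** diag_mat (\<lambda>i. d i powr \<alpha>) ** conj_transpose U"
    using mat_powr_diagonalisation[OF assms(1)] by blast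
  \<comment> \<open>At a zero eigenvalue the convention \<open>0 powr \<alpha> = 0\<close> would
    give the product 0 instead of 1.\<close>
  have "d i \<noteq> 0" for i
  proof
    assume "d i = 0"
    hence "row i (diag_mat d) = 0" by (simp add: row_def diag_mat_def vec_eq_iff)
    hence "det (diag_mat d) = 0" by (rule det_zero_row)
    hence "det A = 0" unfolding U(3) by (simp add: det_mul)
    thus False using assms(2) by (simp add: invertible_det_nz)
  qed
  hence "d i powr \<alpha> * d i powr (- \<alpha>) = 1" for i
    using U(2)[of i] by (simp add: powr_add[symmetric])
  thus ?thesis unfolding U(4) conj_diag_mult[OF U(1)]
    using U(1) by (simp add: diag_mat_one unitary_mat_def)
qed

text \<open>Expresses the sum of the eigenvalues through the entries of the matrix, for which
  integrability is known.\<close>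

lemma trace_conj_diag:
  assumes "unitary_mat U"
  shows "trace (U ** diag_mat d ** conj_transpose U) = complex_of_real (\<Sum>i\<in>UNIV. d i)"
proof -
  have "trace (U ** diag_mat d ** conj_transpose U) = trace (conj_transpose U ** (U ** diag_mat d))"
    by (rule trace_mul_sym)
  also have "\<dots> = trace (diag_mat d)"
    using assms by (simp add: matrix_mul_assoc unitary_mat_def)
  finally show ?thesis by (simp add: trace_def diag_mat_def)
qed

section \<open>The operator norm\<close>

lemma op_norm_bound: "norm (A *v z) \<le> op_norm A * norm z"
  unfolding op_norm_def by (rule onorm) simp

lemma op_norm_leI: "(\<And>z. norm (A *v z) \<le> b * norm z) \<Longrightarrow> op_norm A \<le> b"
  unfolding op_norm_def by (rule onorm_le)

lemma op_norm_nonneg [simp]: "0 \<le> op_norm A"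
  unfolding op_norm_def by (rule onorm_pos_le) simp

lemma op_norm_pos:
  assumes "A \<noteq> 0" shows "0 < op_norm A"
proof -
  have "\<not> (\<forall>z. A *v z = 0)" using assms by (metis matrix_eq matrix_vector_mult_0)
  thus ?thesis unfolding op_norm_def by (subst onorm_pos_lt) auto
qed

lemma op_norm_mult: "op_norm (A ** B) \<le> op_norm A * op_norm B"
  unfolding op_norm_def
  using onorm_compose[of "(*v) A" "(*v) B"] by (simp add: comp_def matrix_vector_mul_assoc)

lemma op_norm_mat_1 [simp]: "op_norm (mat 1 :: complex ^ 'm ^ 'm) = 1"
proof (rule antisym)
  show "op_norm (mat 1 :: complex ^ 'm ^ 'm) \<le> 1" by (rule op_norm_leI) simp
  have "0 < norm (axis undefined 1 :: complex ^ 'm)" by (simp add: axis_eq_0_iff)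
  with op_norm_bound[of "mat 1" "axis undefined 1 :: complex ^ 'm"]
  show "1 \<le> op_norm (mat 1 :: complex ^ 'm ^ 'm)" by simp
qed

lemma op_norm_diff: "op_norm A \<le> op_norm B + op_norm (A - B)"
proof (rule op_norm_leI)
  fix z
  have "norm (A *v z) = norm (B *v z + (A - B) *v z)"
    by (simp add: matrix_vector_mult_diff_rdistrib)
  also have "\<dots> \<le> norm (B *v z) + norm ((A - B) *v z)" by (rule norm_triangle_ineq)
  also have "\<dots> \<le> op_norm B * norm z + op_norm (A - B) * norm z"
    by (intro add_mono op_norm_bound)
  finally show "norm (A *v z) \<le> (op_norm B + op_norm (A - B)) * norm z" by (simp add: algebra_simps)
qed

text \<open>Reducing operators control norms of vectors only; this reduces an operator norm to
  finitely many of them.\<close>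

lemma op_norm_le_columns:
  fixes A :: "complex ^ 'm ^ 'm"
  shows "op_norm A \<le> (\<Sum>j\<in>UNIV. norm (A *v axis j 1))"
proof (rule op_norm_leI)
  fix z :: "complex ^ 'm"
  have "A *v z = (\<Sum>j\<in>UNIV. z $ j *s (A *v axis j 1))"
    by (simp add: matrix_vector_mult_def vec_eq_iff axis_def if_distrib[of "\<lambda>x. _ * x"] mult.commute cong: if_cong)
  also have "norm \<dots> \<le> (\<Sum>j\<in>UNIV. norm (z $ j *s (A *v axis j 1)))" by (rule norm_sum)
  also have "\<dots> \<le> (\<Sum>j\<in>UNIV. norm (A *v axis j 1) * norm z)"
  proof (rule sum_mono)
    fix j
    have "norm (z $ j *s v) = norm (z $ j) * norm v" for v :: "complex ^ 'm"
      by (simp add: norm_vec_def L2_set_def norm_mult power_mult_distrib sum_distrib_left[symmetric] real_sqrt_mult)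
    thus "norm (z $ j *s (A *v axis j 1)) \<le> norm (A *v axis j 1) * norm z"
      by (simp add: mult.commute[of "norm (A *v _)"] mult_right_mono Finite_Cartesian_Product.norm_nth_le)
  qed
  finally show "norm (A *v z) \<le> (\<Sum>j\<in>UNIV. norm (A *v axis j 1)) * norm z" by (simp add: sum_distrib_right)
qed

text \<open>The constant is crude; the bound serves as a Lipschitz estimate and so for continuity of
  \<open>op_norm\<close>.\<close>

lemma op_norm_le_norm:
  fixes A :: "complex ^ 'm ^ 'm"
  shows "op_norm A \<le> (real CARD('m))\<^sup>2 * norm A"
proof -
  have col: "norm (A *v axis j 1) \<le> real CARD('m) * norm A" for j
  proof -
    have "norm (A *v axis j 1) \<le> (\<Sum>i\<in>UNIV. norm ((A *v axis j 1) $ i))"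
      by (simp add: norm_vec_def L2_set_le_sum)
    also have "\<dots> \<le> (\<Sum>i\<in>(UNIV::'m set). norm A)"
    proof (rule sum_mono)
      fix i
      have "(A *v axis j 1) $ i = A $ i $ j"
        by (simp add: matrix_vector_mult_def axis_def if_distrib[of "\<lambda>x. _ * x"] cong: if_cong)
      thus "norm ((A *v axis j 1) $ i) \<le> norm A"
        using Finite_Cartesian_Product.norm_nth_le[of "A $ i" j] Finite_Cartesian_Product.norm_nth_le[of A i] by simp
    qed
    finally show ?thesis by simp
  qed
  have "op_norm A \<le> (\<Sum>j\<in>(UNIV::'m set). norm (A *v axis j 1))" by (rule op_norm_le_columns)
  also have "\<dots> \<le> (\<Sum>j\<in>(UNIV::'m set). real CARD('m) * norm A)" by (intro sum_mono col)
  finally show ?thesis by (simp add: power2_eq_square algebra_simps)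
qed

lemma continuous_on_op_norm [continuous_intros]:
  fixes f :: "'a::topological_space \<Rightarrow> complex ^ 'm ^ 'm"
  assumes "continuous_on S f"
  shows "continuous_on S (\<lambda>x. op_norm (f x))"
proof -
  have "((real CARD('m))\<^sup>2)-lipschitz_on UNIV (op_norm :: complex ^ 'm ^ 'm \<Rightarrow> real)"
  proof (rule lipschitz_onI)
    fix A B :: "complex ^ 'm ^ 'm"
    have "op_norm A - op_norm B \<le> (real CARD('m))\<^sup>2 * norm (A - B)" for A B :: "complex ^ 'm ^ 'm"
      using op_norm_diff[of A B] op_norm_le_norm[of "A - B"] by linarith
    from this[of A B] this[of B A]
    show "dist (op_norm A) (op_norm B) \<le> (real CARD('m))\<^sup>2 * dist A B"
      by (auto simp: dist_norm norm_minus_commute)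
  qed simp
  hence "continuous_on UNIV (op_norm :: complex ^ 'm ^ 'm \<Rightarrow> real)" by (rule lipschitz_on_continuous_on)
  from continuous_on_compose2[OF this assms] show ?thesis by simp
qed

lemma continuous_on_matrix_mult [continuous_intros]:
  fixes f g :: "'a::topological_space \<Rightarrow> complex ^ 'm ^ 'm"
  assumes "continuous_on S f" "continuous_on S g"
  shows "continuous_on S (\<lambda>x. f x ** g x)"
  unfolding matrix_matrix_mult_def by (intro continuous_intros assms)

lemma norm_unitary_mult:
  fixes U :: "complex ^ 'm ^ 'm"
  assumes "unitary_mat U"
  shows "norm (U *v z) = norm z" "norm (conj_transpose U *v z) = norm z"
proof -
  have adj: "cip x (A *v y) = cip (conj_transpose A *v x) y" for A :: "complex^'m^'m" and x y
  proof -
    have "cip x (A *v y) = (\<Sum>i\<in>UNIV. \<Sum>j\<in>UNIV. cnj (x $ i) * A $ i $ j * y $ j)"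
      by (simp add: cip_def matrix_vector_mult_def sum_distrib_left mult_ac)
    also have "\<dots> = (\<Sum>j\<in>UNIV. \<Sum>i\<in>UNIV. cnj (x $ i) * A $ i $ j * y $ j)" by (rule sum.swap)
    also have "\<dots> = cip (conj_transpose A *v x) y"
      by (simp add: cip_def matrix_vector_mult_def conj_transpose_def sum_distrib_left sum_distrib_right mult_ac)
    finally show ?thesis .
  qed
  have *: "norm (V *v z) = norm z" if "conj_transpose V ** V = mat 1" for V :: "complex^'m^'m"
  proof -
    have "cip (V *v z) (V *v z) = cip z z"
      by (simp add: adj[of _ V] matrix_vector_mul_assoc that)
    hence "(norm (V *v z))\<^sup>2 = (norm z)\<^sup>2" unfolding cip_self of_real_eq_iff .
    thus ?thesis by simp
  qed
  have "conj_transpose (conj_transpose U) = U" by (simp add: conj_transpose_def vec_eq_iff)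
  thus "norm (U *v z) = norm z" "norm (conj_transpose U *v z) = norm z"
    using assms *[of U] *[of "conj_transpose U"] by (simp_all add: unitary_mat_def)
qed

text \<open>The norm on the left is governed by the largest eigenvalue, and the trace is the sum of
  all of them. Local integrability of the entries of a weight thereby controls the norm of its
  root.\<close>

lemma op_norm_mat_powr_le_trace:
  fixes A :: "complex ^ 'm ^ 'm"
  assumes "nonneg_definite A" "0 < p"
  shows "op_norm (mat_powr A (1 / p)) powr p \<le> Re (trace A)"
proof -
  obtain U d where U: "unitary_mat U" "\<And>i. 0 \<le> d i" "A = U ** diag_mat d ** conj_transpose U"
    "\<And>\<alpha>. mat_powr A \<alpha> = U ** diag_mat (\<lambda>i. d i powr \<alpha>) ** conj_transpose U"
    using mat_powr_diagonalisation[OF assms(1)] by blast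
  have tr: "Re (trace A) = (\<Sum>i\<in>UNIV. d i)" unfolding U(3) trace_conj_diag[OF U(1)] by simp
  have s0: "0 \<le> (\<Sum>i\<in>UNIV. d i)" by (simp add: sum_nonneg U)
  define F where "F = (\<Sum>i\<in>UNIV. d i) powr (1 / p)"
  have dF: "d i powr (1 / p) \<le> F" for i
    unfolding F_def using assms(2) U(2) by (intro powr_mono2) (auto intro: member_le_sum)
  have diag: "norm (diag_mat f *v z) \<le> F * norm z" if "\<And>i. 0 \<le> f i \<and> f i \<le> F" for f :: "'m \<Rightarrow> real" and z
  proof -
    have F0: "0 \<le> F" by (simp add: F_def)
    have nth: "(diag_mat f *v z) $ i = complex_of_real (f i) * z $ i" for i
      by (simp add: matrix_vector_mult_def diag_mat_def if_distrib[of "\<lambda>x. x * _"] cong: if_cong)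
    have "norm (diag_mat f *v z) \<le> norm (F *\<^sub>R z)"
      by (rule norm_le_componentwise_cart) (use that F0 in \<open>simp add: nth norm_mult mult_right_mono\<close>)
    thus ?thesis using F0 by simp
  qed
  have "op_norm (mat_powr A (1 / p)) \<le> F"
  proof (rule op_norm_leI)
    fix z
    have "norm (mat_powr A (1 / p) *v z)
        = norm (U *v (diag_mat (\<lambda>i. d i powr (1 / p)) *v (conj_transpose U *v z)))"
      unfolding U(4) by (simp add: matrix_vector_mul_assoc matrix_mul_assoc)
    also have "\<dots> = norm (diag_mat (\<lambda>i. d i powr (1 / p)) *v (conj_transpose U *v z))"
      by (rule norm_unitary_mult[OF U(1)])
    also have "\<dots> \<le> F * norm (conj_transpose U *v z)"
      by (rule diag) (use dF in auto)
    finally show "norm (mat_powr A (1 / p) *v z) \<le> F * norm z" by (simp add: norm_unitary_mult[OF U(1)])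
  qed
  hence "op_norm (mat_powr A (1 / p)) powr p \<le> F powr p" using assms(2) by (intro powr_mono2) auto
  thus ?thesis using assms(2) s0 by (simp add: F_def powr_powr tr)
qed

section \<open>Measurability of matrix powers\<close>

text \<open>The function \<open>t powr \<alpha>\<close>, which vanishes at \<open>0\<close>, is of the first Baire class on \<open>{0..}\<close> for every
  real \<open>\<alpha>\<close>, also for negative ones.\<close>

lemma powr_pointwise_limit_of_polynomials:
  fixes \<alpha> :: real
  obtains a :: "nat \<Rightarrow> nat \<Rightarrow> real" and N :: "nat \<Rightarrow> nat"
  where "\<And>t. 0 \<le> t \<Longrightarrow> (\<lambda>k. \<Sum>i\<le>N k. a k i * t ^ i) \<longlonglongrightarrow> t powr \<alpha>"
proof -
  \<comment> \<open>The maximum keeps negative powers bounded near 0, and the first factor forces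
    the value 0 at 0. For t \<ge> 1/(k+1) both are inert, so \<open>g k t\<close> is eventually
    \<open>t powr \<alpha>\<close>.\<close>
  define g where "g k t = min 1 (real (Suc k) * t) * max t (1 / real (Suc k)) powr \<alpha>" for k t
  have "\<exists>b n. \<forall>t\<in>{0..real (Suc k)}. \<bar>g k t - (\<Sum>i\<le>n. b i * t ^ i)\<bar> < 1 / real (Suc k)" for k
  proof -
    have pos: "0 < max t (1 / real (Suc k))" for t by (simp add: less_max_iff_disj)
    have "continuous_on {0..real (Suc k)} (g k)"
      unfolding g_def using pos by (intro continuous_intros) (auto simp: less_le)
    from Stone_Weierstrass_real_polynomial_function[OF compact_Icc this, of "1 / real (Suc k)"]
    obtain q where q: "real_polynomial_function q"
      "\<And>t. t \<in> {0..real (Suc k)} \<Longrightarrow> \<bar>g k t - q t\<bar> < 1 / real (Suc k)" by auto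
    obtain b n where "q = (\<lambda>x. \<Sum>i\<le>n. b i * x ^ i)" using q(1) real_polynomial_function_iff_sum by blast
    thus ?thesis using q(2) by blast
  qed
  then obtain a N where aN: "\<And>k t. t \<in> {0..real (Suc k)} \<Longrightarrow>
      \<bar>g k t - (\<Sum>i\<le>N k. a k i * t ^ i)\<bar> < 1 / real (Suc k)" by metis
  have "(\<lambda>k. \<Sum>i\<le>N k. a k i * t ^ i) \<longlonglongrightarrow> t powr \<alpha>" if t: "0 \<le> t" for t
  proof -
    have "\<forall>\<^sub>F k in sequentially. g k t = t powr \<alpha>"
    proof (cases "t = 0")
      case True thus ?thesis by (simp add: g_def)
    next
      case False
      obtain K where K: "1 / t < real K" using reals_Archimedean2 by blast
      have "g k t = t powr \<alpha>" if "k \<ge> K" for k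
      proof -
        have "1 / t < real (Suc k)" using K that by linarith
        hence "1 < real (Suc k) * t" "1 / real (Suc k) < t" using t False by (simp_all add: field_simps)
        thus ?thesis by (simp add: g_def)
      qed
      thus ?thesis unfolding eventually_sequentially by blast
    qed
    hence 1: "(\<lambda>k. g k t) \<longlonglongrightarrow> t powr \<alpha>" by (rule tendsto_eventually)
    obtain K where K: "t < real K" using reals_Archimedean2 by blast
    have "\<forall>\<^sub>F k in sequentially. norm (g k t - (\<Sum>i\<le>N k. a k i * t ^ i)) \<le> 1 / real (Suc k)"
      unfolding eventually_sequentially
    proof (intro exI[of _ K] allI impI)
      fix k assume "K \<le> k"
      hence "t \<in> {0..real (Suc k)}" using K t by auto
      from aN[OF this] show "norm (g k t - (\<Sum>i\<le>N k. a k i * t ^ i)) \<le> 1 / real (Suc k)" by simp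
    qed
    moreover have "(\<lambda>k. 1 / real (Suc k)) \<longlonglongrightarrow> 0" using LIMSEQ_inverse_real_of_nat by (simp add: inverse_eq_divide)
    ultimately have "(\<lambda>k. g k t - (\<Sum>i\<le>N k. a k i * t ^ i)) \<longlonglongrightarrow> 0" by (rule Lim_null_comparison)
    from tendsto_diff[OF 1 this] show ?thesis by simp
  qed
  with that show ?thesis by blast
qed

primrec mat_pow :: "complex ^ 'm ^ 'm \<Rightarrow> nat \<Rightarrow> complex ^ 'm ^ 'm" where
  "mat_pow A 0 = mat 1"
| "mat_pow A (Suc k) = A ** mat_pow A k"

lemma continuous_on_mat_pow [continuous_intros]: "continuous_on S (\<lambda>A. mat_pow A k)"
  by (induction k) (auto intro!: continuous_intros)

lemma mat_pow_conj_diag: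
  assumes "unitary_mat U"
  shows "mat_pow (U ** diag_mat d ** conj_transpose U) k
    = U ** diag_mat (\<lambda>i. d i ^ k) ** conj_transpose U"
proof (induction k)
  case 0
  show ?case using assms by (simp add: diag_mat_one unitary_mat_def)
next
  case (Suc k)
  thus ?case by (simp add: conj_diag_mult[OF assms])
qed

text \<open>Matrix polynomials are continuous, and suitable ones converge pointwise to the power.
  The diagonalisation enters pointwise, to identify the limit.\<close>

lemma borel_measurable_mat_powr:
  fixes W :: "'a \<Rightarrow> complex ^ 'm ^ 'm"
  assumes "W \<in> borel_measurable M" "\<And>x. nonneg_definite (W x)"
  shows "(\<lambda>x. mat_powr (W x) \<alpha>) \<in> borel_measurable M"
proof -
  obtain a :: "nat \<Rightarrow> nat \<Rightarrow> real" and N :: "nat \<Rightarrow> nat"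
    where lim: "\<And>t. 0 \<le> t \<Longrightarrow> (\<lambda>k. \<Sum>i\<le>N k. a k i * t ^ i) \<longlonglongrightarrow> t powr \<alpha>"
    using powr_pointwise_limit_of_polynomials by blast
  define P where "P k B = (\<Sum>r\<le>N k. a k r *\<^sub>R mat_pow B r)" for k and B :: "complex^'m^'m"
  have "continuous_on UNIV (P k)" for k
    unfolding P_def by (intro continuous_intros)
  hence meas: "(\<lambda>x. P k (W x)) \<in> borel_measurable M" for k
    using assms(1) by (rule borel_measurable_continuous_on)
  have "(\<lambda>k. P k (W x)) \<longlonglongrightarrow> mat_powr (W x) \<alpha>" for x
  proof -
    obtain U d where U: "unitary_mat U" "\<And>i. 0 \<le> d i" "W x = U ** diag_mat d ** conj_transpose U"
      "\<And>\<alpha>. mat_powr (W x) \<alpha> = U ** diag_mat (\<lambda>i. d i powr \<alpha>) ** conj_transpose U"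
      using mat_powr_diagonalisation[OF assms(2)[of x]] by blast
    have P: "P k (W x) $ i $ j = (\<Sum>l\<in>UNIV. complex_of_real (\<Sum>r\<le>N k. a k r * d l ^ r) * (U $ i $ l * cnj (U $ j $ l)))"
      for k i j
    proof -
      have "P k (W x) $ i $ j = (\<Sum>r\<le>N k. complex_of_real (a k r) * (\<Sum>l\<in>UNIV. complex_of_real (d l ^ r) * (U $ i $ l * cnj (U $ j $ l))))"
        unfolding P_def U(3) mat_pow_conj_diag[OF U(1)]
        by (simp add: conj_diag_nth scaleR_conv_of_real[where 'a=complex])
      also have "\<dots> = (\<Sum>r\<le>N k. \<Sum>l\<in>UNIV. complex_of_real (a k r * d l ^ r) * (U $ i $ l * cnj (U $ j $ l)))"
        by (simp add: sum_distrib_left mult_ac)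
      also have "\<dots> = (\<Sum>l\<in>UNIV. \<Sum>r\<le>N k. complex_of_real (a k r * d l ^ r) * (U $ i $ l * cnj (U $ j $ l)))"
        by (rule sum.swap)
      finally show ?thesis by (simp add: sum_distrib_right)
    qed
    show ?thesis
    proof (intro vec_tendstoI)
      fix i j
      show "(\<lambda>k. P k (W x) $ i $ j) \<longlonglongrightarrow> mat_powr (W x) \<alpha> $ i $ j"
        unfolding P U(4) conj_diag_nth by (intro tendsto_intros lim U(2))
    qed
  qed
  thus ?thesis by (rule borel_measurable_LIMSEQ_metric[OF meas])
qed

section \<open>Cubes\<close>

text \<open>The closed cube with given centre and edge. It differs from any other cube with these
  data by a null set, so integral estimates can be made for closed cubes first.\<close>

definition ccube :: "real ^ 'n \<Rightarrow> real \<Rightarrow> (real ^ 'n) set" where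
  "ccube c l = cbox (\<chi> i. c $ i - l / 2) (\<chi> i. c $ i + l / 2)"

lemma mem_ccube: "x \<in> ccube c l \<longleftrightarrow> (\<forall>i. \<bar>x $ i - c $ i\<bar> \<le> l / 2)"
proof -
  have "(a - l / 2 \<le> b \<and> b \<le> a + l / 2) = (\<bar>b - a\<bar> \<le> l / 2)" for a b :: real by linarith
  thus ?thesis by (simp add: ccube_def mem_box_cart)
qed

lemma cube_at_ccube: "0 < l \<Longrightarrow> cube_at c l (ccube c l)"
  unfolding cube_at_def ccube_def
  by (intro conjI exI[of _ "\<lambda>i. {c $ i - l / 2 .. c $ i + l / 2}"]) (auto simp: mem_box_cart)

lemma is_cube_ccube: "0 < l \<Longrightarrow> is_cube (ccube c l)"
  unfolding is_cube_def using cube_at_ccube by blast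

lemma cube_at_params: "is_cube Q \<Longrightarrow> cube_at (cube_center Q) (edge_length Q) Q"
  unfolding is_cube_def using cube_center_eq edge_length_eq by metis

lemma edge_length_pos: "is_cube Q \<Longrightarrow> 0 < edge_length Q"
  using cube_at_params unfolding cube_at_def by blast

lemma cube_at_null_diff:
  fixes Q :: "(real ^ 'n) set"
  assumes "cube_at c l Q"
  shows "Q \<subseteq> ccube c l" "ccube c l - Q \<in> null_sets lebesgue"
proof -
  show Q: "Q \<subseteq> ccube c l"
    using closure_subset cube_at_closure[OF assms] unfolding ccube_def by blast
  have "box (\<chi> i. c $ i - l / 2) (\<chi> i. c $ i + l / 2) \<subseteq> Q"
    using assms unfolding cube_at_def by (fastforce simp: mem_box_cart)
  hence "ccube c l - Q \<subseteq> cbox (\<chi> i. c $ i - l / 2) (\<chi> i. c $ i + l / 2) - box (\<chi> i. c $ i - l / 2) (\<chi> i. c $ i + l / 2)"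
    unfolding ccube_def by blast
  hence "negligible (ccube c l - Q)" using negligible_frontier_interval negligible_subset by blast
  thus "ccube c l - Q \<in> null_sets lebesgue" by (simp add: negligible_iff_null_sets)
qed

lemma ccube_mono: "l \<le> l' \<Longrightarrow> ccube c l \<subseteq> ccube c l'"
  unfolding subset_iff mem_ccube by (meson order_trans divide_right_mono zero_le_numeral)

lemma measure_ccube:
  fixes c :: "real ^ 'n"
  assumes "0 < l"
  shows "measure lebesgue (ccube c l) = l ^ CARD('n)"
proof -
  have "c \<in> ccube c l" using assms by (simp add: mem_ccube)
  hence "cbox (\<chi> i. c $ i - l / 2) (\<chi> i. c $ i + l / 2) \<noteq> {}" unfolding ccube_def by blast
  from content_cbox_cart[OF this] show ?thesis by (simp add: ccube_def)
qed

lemma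
  fixes Q :: "(real ^ 'n) set"
  assumes "is_cube Q"
  shows cube_lmeasurable: "Q \<in> lmeasurable"
    and measure_cube: "measure lebesgue Q = edge_length Q ^ CARD('n)"
proof -
  note at = cube_at_params[OF assms]
  let ?C = "ccube (cube_center Q) (edge_length Q)"
  note nd = cube_at_null_diff[OF at]
  have Q: "Q = ?C - (?C - Q)" using nd(1) by blast
  have C: "?C \<in> lmeasurable" unfolding ccube_def by (rule lmeasurable_cbox)
  have N: "?C - Q \<in> lmeasurable" using nd(2) by (auto simp: fmeasurable_def null_sets_def)
  show "Q \<in> lmeasurable" by (subst Q) (intro fmeasurable.Diff C N)
  have "measure lebesgue Q = measure lebesgue ?C"
    by (rule measure_negligible_symdiff) (use C nd in \<open>auto simp: negligible_iff_null_sets Diff_eq_empty_iff[THEN iffD2]\<close>)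
  thus "measure lebesgue Q = edge_length Q ^ CARD('n)"
    using measure_ccube edge_length_pos[OF assms] by metis
qed

lemma measure_cube_pos:
  fixes Q :: "(real ^ 'n) set"
  shows "is_cube Q \<Longrightarrow> 0 < measure lebesgue Q"
  by (simp add: measure_cube edge_length_pos)

lemma cube_sets_lebesgue: "is_cube Q \<Longrightarrow> Q \<in> sets lebesgue"
  using cube_lmeasurable by blast

lemma set_borel_measurable_lebesgue:
  fixes f :: "real ^ 'n \<Rightarrow> real"
  assumes "f \<in> borel_measurable lebesgue" "S \<in> sets lebesgue"
  shows "set_borel_measurable lebesgue S f"
  unfolding set_borel_measurable_def using assms by measurable

lemma set_integral_closed_cube:
  fixes f :: "real ^ 'n \<Rightarrow> real"
  assumes "cube_at c l Q" "f \<in> borel_measurable lebesgue"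
  shows "(LINT x:ccube c l|lebesgue. f x) = (LINT x:Q|lebesgue. f x)"
proof (rule set_integral_cong_set)
  have l: "0 < l" "is_cube Q" using assms(1) by (auto simp: cube_at_def is_cube_def)
  show "set_borel_measurable lebesgue (ccube c l) f" "set_borel_measurable lebesgue Q f"
    using l by (auto intro!: set_borel_measurable_lebesgue assms(2) cube_sets_lebesgue is_cube_ccube)
  have "AE x in lebesgue. x \<notin> ccube c l - Q"
    using cube_at_null_diff(2)[OF assms(1)] by (rule AE_not_in)
  thus "AE x in lebesgue. (x \<in> Q) = (x \<in> ccube c l)"
    using cube_at_null_diff(1)[OF assms(1)] by auto
qed

text \<open>Taking closures removes the dependence on the faces; the two extreme corners of the
  smaller cube then give the inequalities.\<close>

lemma cube_subset_coords:
  assumes "cube_at c l Q" "cube_at c' l' R" "Q \<subseteq> R"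
  shows "\<bar>c $ i - c' $ i\<bar> \<le> (l' - l) / 2" and "l \<le> l'"
proof -
  have l: "0 < l" using assms(1) by (simp add: cube_at_def)
  have "ccube c l \<subseteq> ccube c' l'"
    unfolding ccube_def using cube_at_closure[OF assms(1)] cube_at_closure[OF assms(2)]
      closure_mono[OF assms(3)] by simp
  moreover have "(\<chi> i. c $ i - l / 2) \<in> ccube c l" "(\<chi> i. c $ i + l / 2) \<in> ccube c l"
    using l by (simp_all add: mem_ccube)
  ultimately have "(\<chi> i. c $ i - l / 2) \<in> ccube c' l'" "(\<chi> i. c $ i + l / 2) \<in> ccube c' l'"
    by blast+
  hence "\<bar>c $ i - l / 2 - c' $ i\<bar> \<le> l' / 2" "\<bar>c $ i + l / 2 - c' $ i\<bar> \<le> l' / 2"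
    unfolding mem_ccube vec_lambda_beta by blast+
  thus 1: "\<bar>c $ i - c' $ i\<bar> \<le> (l' - l) / 2" by argo
  thus "l \<le> l'" by argo
qed

section \<open>Averages and Jensen's inequality\<close>

lemma integrable_const_lmeasurable [simp]:
  "F \<in> lmeasurable \<Longrightarrow> set_integrable lebesgue F (\<lambda>_. c :: real)"
  unfolding set_integrable_def by (auto simp: fmeasurable_def intro!: integrable_real_mult_indicator)

lemma avg_mono_AE:
  assumes "set_integrable lebesgue E f" "set_integrable lebesgue E g"
    "AE x in lebesgue. f x \<le> g x"
  shows "avg E f \<le> avg E g"
  unfolding avg_def using assms
  by (intro divide_right_mono set_integral_mono_AE) auto

lemma avg_add:
  assumes "set_integrable lebesgue E f" "set_integrable lebesgue E g"
  shows "avg E (\<lambda>x. f x + g x) = avg E f + avg E g"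
  unfolding avg_def using assms by (simp add: add_divide_distrib)

lemma avg_cmult: "avg E (\<lambda>x. c * f x) = c * avg E f"
  unfolding avg_def by simp

lemma avg_const: "E \<in> lmeasurable \<Longrightarrow> 0 < measure lebesgue E \<Longrightarrow> avg E (\<lambda>_. c) = c"
  unfolding avg_def by (subst set_integral_const) (auto simp: fmeasurable_def)

lemma avg_sum:
  assumes "\<And>i. i \<in> I \<Longrightarrow> set_integrable lebesgue E (f i)"
  shows "avg E (\<lambda>x. \<Sum>i\<in>I. f i x) = (\<Sum>i\<in>I. avg E (f i))"
  using assms unfolding avg_def set_integrable_def set_lebesgue_integral_def
  by (simp add: sum_distrib_left sum_divide_distrib)

lemma avg_nonneg: "(\<And>x. 0 \<le> f x) \<Longrightarrow> 0 \<le> avg E f"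
  unfolding avg_def set_lebesgue_integral_def
  by (intro divide_nonneg_nonneg Bochner_Integration.integral_nonneg) auto

lemma avg_pos:
  assumes F: "F \<in> lmeasurable" "0 < measure lebesgue F"
    and w: "set_integrable lebesgue F w" "\<And>x. 0 \<le> w x" "AE x in lebesgue. 0 < w x"
  shows "0 < avg F w"
proof -
  have "(LINT x:F|lebesgue. w x) \<noteq> 0"
  proof
    assume "(LINT x:F|lebesgue. w x) = 0"
    hence "AE x in lebesgue. indicator F x *\<^sub>R w x = 0"
      using w(1,2) unfolding set_lebesgue_integral_def set_integrable_def
      by (subst (asm) integral_nonneg_eq_0_iff_AE) auto
    with w(3) have "AE x in lebesgue. x \<notin> F"
      by eventually_elim (auto simp: indicator_def split: if_splits)
    hence "F \<in> null_sets lebesgue" using F(1) by (simp add: AE_iff_null_sets fmeasurableD)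
    thus False using F(2) by (simp add: measure_eq_0_null_sets)
  qed
  moreover have "0 \<le> (LINT x:F|lebesgue. w x)"
    unfolding set_lebesgue_integral_def
    using w(2) by (intro Bochner_Integration.integral_nonneg) auto
  ultimately show ?thesis using F(2) by (simp add: avg_def)
qed

text \<open>Jensen's inequality by integrating the tangent line of the logarithm at the mean: ln t
  \<le> t/a + ln a - 1.\<close>

lemma avg_ln_le:
  assumes F: "F \<in> lmeasurable" "0 < measure lebesgue F"
    and w: "set_integrable lebesgue F w" "\<And>x. 0 \<le> w x" "AE x in lebesgue. 0 < w x"
    and lnw: "set_integrable lebesgue F (\<lambda>x. ln (w x))"
  shows "avg F (\<lambda>x. ln (w x)) \<le> ln (avg F w)"
proof -
  define a where "a = avg F w"
  have a: "0 < a" unfolding a_def by (rule avg_pos[OF F w])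
  have "avg F (\<lambda>x. ln (w x)) \<le> avg F (\<lambda>x. (1 / a) * w x + (ln a - 1))"
  proof (rule avg_mono_AE)
    show "set_integrable lebesgue F (\<lambda>x. (1 / a) * w x + (ln a - 1))"
      by (intro set_integral_add set_integrable_mult_right w F integrable_const_lmeasurable)
    show "AE x in lebesgue. ln (w x) \<le> (1 / a) * w x + (ln a - 1)"
      using w(3)
    proof eventually_elim
      case (elim x)
      have "ln (w x / a) \<le> w x / a - 1" using elim a by (intro ln_le_minus_one) simp
      thus ?case using elim a by (simp add: ln_div)
    qed
  qed fact
  also have "\<dots> = avg F (\<lambda>x. (1 / a) * w x) + avg F (\<lambda>x. ln a - 1)"
    by (intro avg_add set_integrable_mult_right w F integrable_const_lmeasurable)
  also have "\<dots> = ln a" using a unfolding avg_cmult avg_const[OF F] by (simp add: a_def)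
  finally show ?thesis by (simp add: a_def)
qed

text \<open>Jensen's inequality is applied separately on \<open>F\<close> and on its complement in \<open>R\<close>; on the complement
  the average is trivially at most \<open>1 / (1 - \<theta>)\<close> times the average over \<open>R\<close>.\<close>

lemma exp_log_bound_subset:
  fixes R F :: "(real ^ 'a) set"
  assumes R: "R \<in> lmeasurable" "0 < measure lebesgue R"
    and F: "F \<in> lmeasurable" "F \<subseteq> R" "measure lebesgue F = \<theta> * measure lebesgue R"
    and \<theta>: "0 < \<theta>" "\<theta> < 1" and K: "0 < K"
    and w: "set_integrable lebesgue R w" "\<And>x. 0 \<le> w x" "AE x in lebesgue. 0 < w x"
    and lnw: "set_integrable lebesgue R (\<lambda>x. ln (w x))"
    and le: "avg R w \<le> K * exp (avg R (\<lambda>x. ln (w x)))"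
  shows "avg R w \<le> exp ((ln K - (1 - \<theta>) * ln (1 - \<theta>)) / \<theta>) * avg F w"
proof -
  define E where "E = R - F"
  define r where "r = measure lebesgue R"
  have E: "E \<in> lmeasurable" unfolding E_def by (intro fmeasurable.Diff R F)
  have mE: "measure lebesgue E = (1 - \<theta>) * r"
    unfolding E_def r_def using F R by (simp add: measurable_measure_Diff fmeasurableD algebra_simps)
  have r: "0 < r" "0 < (1 - \<theta>) * r" "0 < \<theta> * r" using R(2) \<theta> by (simp_all add: r_def)
  have mF: "measure lebesgue F = \<theta> * r" by (simp add: F(3) r_def)
  have Rsplit: "R = F \<union> E" "F \<inter> E = {}" "E \<subseteq> R" using F(2) by (auto simp: E_def)
  have int: "set_integrable lebesgue F f" "set_integrable lebesgue E f"
    if "set_integrable lebesgue R f" for f :: "real ^ 'a \<Rightarrow> real"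
    using set_integrable_subset[OF that fmeasurableD[OF F(1)] F(2)]
      set_integrable_subset[OF that fmeasurableD[OF E] Rsplit(3)] by blast+
  \<comment> \<open>Averages over \<open>R\<close> are convex combinations, with the volume
    fractions of \<open>F\<close> and \<open>E\<close> as weights.\<close>
  have split: "avg R f = \<theta> * avg F f + (1 - \<theta>) * avg E f" if "set_integrable lebesgue R f"
    for f :: "real ^ 'a \<Rightarrow> real"
  proof -
    have "(LINT x:R|lebesgue. f x) = (LINT x:F|lebesgue. f x) + (LINT x:E|lebesgue. f x)"
      by (subst Rsplit(1), rule set_integral_Un) (use int[OF that] Rsplit in auto)
    thus ?thesis using r \<theta> unfolding avg_def mF mE by (simp add: r_def[symmetric] add_divide_distrib)
  qed
  define a b e where "a = avg R w" and "b = avg F w" and "e = avg E w"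
  have pos: "0 < a" "0 < b" "0 < e"
    unfolding a_def b_def e_def
    using r mE mF by (auto intro!: avg_pos R F E w int)
  have "a = \<theta> * b + (1 - \<theta>) * e" unfolding a_def b_def e_def by (rule split[OF w(1)])
  hence "(1 - \<theta>) * e \<le> a" using pos \<theta> by (simp add: mult_pos_pos less_imp_le)
  hence "ln ((1 - \<theta>) * e) \<le> ln a" using pos \<theta> by (subst ln_le_cancel_iff) auto
  hence lne: "ln e \<le> ln a - ln (1 - \<theta>)" using pos \<theta> by (simp add: ln_mult)
  have "ln a \<le> ln (K * exp (avg R (\<lambda>x. ln (w x))))"
    using le pos K by (subst ln_le_cancel_iff) (auto simp: a_def)
  also have "\<dots> = ln K + (\<theta> * avg F (\<lambda>x. ln (w x)) + (1 - \<theta>) * avg E (\<lambda>x. ln (w x)))"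
    using K by (simp add: ln_mult split[OF lnw])
  also have "\<dots> \<le> ln K + (\<theta> * ln b + (1 - \<theta>) * ln e)"
    unfolding b_def e_def using \<theta> r mE mF
    by (intro add_left_mono add_mono mult_left_mono avg_ln_le F E w int lnw) auto
  also have "\<dots> \<le> ln K + (\<theta> * ln b + (1 - \<theta>) * (ln a - ln (1 - \<theta>)))"
    using lne \<theta> by (intro add_left_mono mult_left_mono) auto
  \<comment> \<open>The term (1 - \<theta>) ln a from the complement is absorbed into the left side,
    leaving \<theta> ln a. This is where the division by \<theta> in the final constant comes
    from.\<close>
  finally have "\<theta> * ln a \<le> ln K - (1 - \<theta>) * ln (1 - \<theta>) + \<theta> * ln b" by (simp add: algebra_simps)
  hence "ln a \<le> (ln K - (1 - \<theta>) * ln (1 - \<theta>)) / \<theta> + ln b"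
    using \<theta> by (simp add: field_simps)
  hence "exp (ln a) \<le> exp ((ln K - (1 - \<theta>) * ln (1 - \<theta>)) / \<theta> + ln b)" by simp
  thus ?thesis using pos by (simp add: exp_add a_def b_def)
qed

section \<open>Growth of scalar weights\<close>

text \<open>A reverse Jensen inequality on every cube, with one constant. Integrability of the
  logarithm belongs to the condition because the Bochner integral of a nonintegrable function is 0
  by default.\<close>

definition exp_log_Ainf :: "real \<Rightarrow> (real ^ 'n \<Rightarrow> real) \<Rightarrow> bool" where
  "exp_log_Ainf K w \<longleftrightarrow> w \<in> borel_measurable lebesgue \<and> (\<forall>x. 0 \<le> w x) \<and> (AE x in lebesgue. 0 < w x) \<and>
    (\<forall>Q. is_cube Q \<longrightarrow> set_integrable lebesgue Q w \<and> set_integrable lebesgue Q (\<lambda>x. ln (w x)) \<and>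
      avg Q w \<le> K * exp (avg Q (\<lambda>x. ln (w x))))"

lemma exp_log_AinfD:
  assumes "exp_log_Ainf K w"
  shows "w \<in> borel_measurable lebesgue" "\<And>x. 0 \<le> w x" "AE x in lebesgue. 0 < w x"
    "\<And>Q. is_cube Q \<Longrightarrow> set_integrable lebesgue Q w"
    "\<And>Q. is_cube Q \<Longrightarrow> set_integrable lebesgue Q (\<lambda>x. ln (w x))"
    "\<And>Q. is_cube Q \<Longrightarrow> avg Q w \<le> K * exp (avg Q (\<lambda>x. ln (w x)))"
  using assms unfolding exp_log_Ainf_def by blast+

section \<open>Doubling and reverse doubling on closed cubes\<close>

lemma set_integral_mono_set_nonneg:
  fixes w :: "real ^ 'n \<Rightarrow> real"
  assumes "set_integrable lebesgue B w" "A \<in> sets lebesgue" "A \<subseteq> B" "\<And>x. 0 \<le> w x"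
  shows "(LINT x:A|lebesgue. w x) \<le> (LINT x:B|lebesgue. w x)"
proof -
  have "set_integrable lebesgue A w" using assms by (auto intro: set_integrable_subset)
  thus ?thesis using assms unfolding set_lebesgue_integral_def set_integrable_def
    by (intro integral_mono) (auto simp: indicator_def)
qed

lemma half_cube_fraction:
  "measure lebesgue (ccube c l) = (1 / 2) ^ CARD('n) * measure lebesgue (ccube c' (2 * l))"
  if "0 < l" for c c' :: "real ^ 'n"
  using that by (simp add: measure_ccube power_mult_distrib power_one_over field_simps)

lemma one_half_power: "0 < (1 / 2 :: real) ^ CARD('n::finite)" "(1 / 2 :: real) ^ CARD('n) < 1"
  by (auto intro: power_less_one_iff[THEN iffD2])

text \<open>The half-size cube has the fixed volume fraction 1/2^n. \<open>D\<close> is chosen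
  before \<open>w\<close>, so it is uniform over all weights with constant \<open>K\<close>; later
  one weight arises for each vector z.\<close>

lemma doubling:
  fixes K :: real
  assumes K: "0 < K"
  obtains D where "1 \<le> D" "\<And>w (c :: real ^ 'n) l. exp_log_Ainf K w \<Longrightarrow> 0 < l \<Longrightarrow>
    (LINT x:ccube c (2 * l)|lebesgue. w x) \<le> D * (LINT x:ccube c l|lebesgue. w x)"
proof -
  define \<theta> :: real where "\<theta> = (1 / 2) ^ CARD('n)"
  note \<theta> = one_half_power[where 'n='n, folded \<theta>_def]
  \<comment> \<open>The extra division by \<theta> converts a bound between averages into one
    between integrals.\<close>
  define D0 where "D0 = exp ((ln K - (1 - \<theta>) * ln (1 - \<theta>)) / \<theta>) / \<theta>"
  have main: "(LINT x:ccube c (2 * l)|lebesgue. w x) \<le> max 1 D0 * (LINT x:ccube c l|lebesgue. w x)"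
    if w: "exp_log_Ainf K w" and l: "0 < l" for w and c :: "real ^ 'n" and l
  proof -
    note w' = exp_log_AinfD[OF w]
    have l2: "0 < 2 * l" using l by simp
    let ?F = "ccube c l" and ?R = "ccube c (2 * l)"
    have FR: "?F \<subseteq> ?R" using l by (intro ccube_mono) simp
    have mF: "measure lebesgue ?F = \<theta> * measure lebesgue ?R" using half_cube_fraction[OF l] by (simp add: \<theta>_def)
    note cR = is_cube_ccube[OF l2, of c] and cF = is_cube_ccube[OF l, of c]
    have "avg ?R w \<le> exp ((ln K - (1 - \<theta>) * ln (1 - \<theta>)) / \<theta>) * avg ?F w"
      by (rule exp_log_bound_subset[OF cube_lmeasurable[OF cR] measure_cube_pos[OF cR] cube_lmeasurable[OF cF]
          FR mF \<theta> K w'(4)[OF cR] w'(2) w'(3) w'(5)[OF cR] w'(6)[OF cR]])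
    hence "(LINT x:?R|lebesgue. w x) \<le> D0 * (LINT x:?F|lebesgue. w x)"
      using measure_cube_pos[OF cR] \<theta> unfolding avg_def mF D0_def by (simp add: field_simps)
    also have "\<dots> \<le> max 1 D0 * (LINT x:?F|lebesgue. w x)"
      by (intro mult_right_mono) (auto simp: set_lebesgue_integral_def w' intro!: Bochner_Integration.integral_nonneg)
    finally show ?thesis .
  qed
  show ?thesis by (rule that[of "max 1 D0"]) (use main in auto)
qed

text \<open>The complement of the small cube also has a fixed volume fraction, hence carries at
  least 1/D of the mass. At most 1 - 1/D is left for the small cube.\<close>

lemma reverse_doubling:
  fixes K :: real
  assumes K: "0 < K"
  obtains \<rho> :: real where "1 / 2 \<le> \<rho>" "\<rho> < 1"
    "\<And>w (c :: real ^ 'n) c' l. exp_log_Ainf K w \<Longrightarrow> 0 < l \<Longrightarrow> ccube c l \<subseteq> ccube c' (2 * l) \<Longrightarrow>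
    (LINT x:ccube c l|lebesgue. w x) \<le> \<rho> * (LINT x:ccube c' (2 * l)|lebesgue. w x)"
proof -
  define \<theta> :: real where "\<theta> = 1 - (1 / 2) ^ CARD('n)"
  have \<theta>: "0 < \<theta>" "\<theta> < 1" using one_half_power[where 'n='n] by (simp_all add: \<theta>_def)
  define D where "D = exp ((ln K - (1 - \<theta>) * ln (1 - \<theta>)) / \<theta>) / \<theta>"
  have D: "0 < D" using \<theta> by (simp add: D_def)
  \<comment> \<open>The maximum with 1/2 keeps the ratio positive and its binary logarithm at least
    -1, which makes the lower growth exponent nonnegative.\<close>
  have main: "(LINT x:ccube c l|lebesgue. w x) \<le> max (1 / 2) (1 - 1 / D) * (LINT x:ccube c' (2 * l)|lebesgue. w x)"
    if w: "exp_log_Ainf K w" and l: "0 < l" and sub: "ccube c l \<subseteq> ccube c' (2 * l)" for w and c c' :: "real ^ 'n" and l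
  proof -
    note w' = exp_log_AinfD[OF w]
    have l2: "0 < 2 * l" using l by simp
    let ?E = "ccube c l" and ?R = "ccube c' (2 * l)"
    let ?F = "?R - ?E"
    note cR = is_cube_ccube[OF l2, of c'] and cE = is_cube_ccube[OF l, of c]
    note lR = cube_lmeasurable[OF cR] and lE = cube_lmeasurable[OF cE]
    have lF: "?F \<in> lmeasurable" by (intro fmeasurable.Diff lR lE)
    have mF: "measure lebesgue ?F = \<theta> * measure lebesgue ?R"
      using half_cube_fraction[OF l, of c c'] lR lE sub
      by (simp add: measurable_measure_Diff fmeasurableD \<theta>_def algebra_simps)
    have "avg ?R w \<le> exp ((ln K - (1 - \<theta>) * ln (1 - \<theta>)) / \<theta>) * avg ?F w"
      by (rule exp_log_bound_subset[OF lR measure_cube_pos[OF cR] lF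
          Diff_subset mF \<theta> K w'(4)[OF cR] w'(2) w'(3) w'(5)[OF cR] w'(6)[OF cR]])
    hence 1: "(LINT x:?R|lebesgue. w x) \<le> D * (LINT x:?F|lebesgue. w x)"
      using measure_cube_pos[OF cR] \<theta> unfolding avg_def mF D_def by (simp add: field_simps)
    have "?R = ?E \<union> ?F" using sub by blast
    moreover have "(LINT x:?E \<union> ?F|lebesgue. w x) = (LINT x:?E|lebesgue. w x) + (LINT x:?F|lebesgue. w x)"
    proof (rule set_integral_Un)
      show "set_integrable lebesgue ?F w" by (rule set_integrable_subset[OF w'(4)[OF cR]]) (use lF in auto)
    qed (use w'(4)[OF cE] in auto)
    ultimately have 2: "(LINT x:?R|lebesgue. w x) = (LINT x:?E|lebesgue. w x) + (LINT x:?F|lebesgue. w x)" by simp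
    have "(LINT x:?E|lebesgue. w x) \<le> (1 - 1 / D) * (LINT x:?R|lebesgue. w x)"
      using 1 D unfolding 2 by (simp add: field_simps)
    also have "\<dots> \<le> max (1 / 2) (1 - 1 / D) * (LINT x:?R|lebesgue. w x)"
      by (intro mult_right_mono) (auto simp: set_lebesgue_integral_def w' intro!: Bochner_Integration.integral_nonneg)
    finally show ?thesis .
  qed
  show ?thesis by (rule that[of "max (1 / 2) (1 - 1 / D)"]) (use main D in auto)
qed

section \<open>Iteration from single doublings to power growth\<close>

lemma intermediate_cube:
  fixes c c' :: "real ^ 'n"
  assumes "\<And>i. \<bar>c $ i - c' $ i\<bar> \<le> (l' - l) / 2" "2 * l \<le> l'" "0 < l"
  obtains c'' where "\<And>i. \<bar>c'' $ i - c' $ i\<bar> \<le> l' / 4" "\<And>i. \<bar>c $ i - c'' $ i\<bar> \<le> (l' / 2 - l) / 2"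
proof
  \<comment> \<open>The centre \<open>c\<close> is projected, coordinate by coordinate, onto the
    range in which a cube of edge \<open>l' / 2\<close> stays inside the outer cube. The two claims
    express the inclusions of the outer and the inner cube.\<close>
  let ?c = "\<chi> i. max (c' $ i - l' / 4) (min (c' $ i + l' / 4) (c $ i))"
  fix i
  show "\<bar>?c $ i - c' $ i\<bar> \<le> l' / 4" "\<bar>c $ i - ?c $ i\<bar> \<le> (l' / 2 - l) / 2"
    using assms(1)[of i] assms(2,3) by (auto simp: max_def min_def abs_if field_simps split: if_splits)
qed

text \<open>The outer cube is halved \<open>k\<close> times around the fixed inner one, each halving
  gaining a factor \<rho>. Its centre moves in every step, so the induction generalises over
  it.\<close>

lemma iterated_reverse_doubling:
  fixes c c' :: "real ^ 'n"
  assumes step: "\<And>(c :: real ^ 'n) c' l. 0 < l \<Longrightarrow> ccube c l \<subseteq> ccube c' (2 * l) \<Longrightarrow>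
      (LINT x:ccube c l|lebesgue. w x) \<le> \<rho> * (LINT x:ccube c' (2 * l)|lebesgue. w x)"
    and w: "exp_log_Ainf K w" and \<rho>: "0 < \<rho>"
  shows "0 < l \<Longrightarrow> 2 ^ k * l \<le> l' \<Longrightarrow> (\<And>i. \<bar>c $ i - c' $ i\<bar> \<le> (l' - l) / 2) \<Longrightarrow>
    (LINT x:ccube c l|lebesgue. w x) \<le> \<rho> ^ k * (LINT x:ccube c' l'|lebesgue. w x)"
proof (induction k arbitrary: c' l')
  case 0
  have "ccube c l \<subseteq> ccube c' l'"
  proof
    fix x assume x: "x \<in> ccube c l"
    have "\<bar>x $ i - c' $ i\<bar> \<le> l' / 2" for i
      using 0(3)[of i] x[unfolded mem_ccube, rule_format, of i] by argo
    thus "x \<in> ccube c' l'" by (simp add: mem_ccube)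
  qed
  moreover have "0 < l'" using 0 by simp
  ultimately have "(LINT x:ccube c l|lebesgue. w x) \<le> (LINT x:ccube c' l'|lebesgue. w x)"
    using 0(1) by (intro set_integral_mono_set_nonneg exp_log_AinfD[OF w] cube_sets_lebesgue is_cube_ccube)
  thus ?case by simp
next
  case (Suc k)
  have "l \<le> 2 ^ k * l" using Suc.prems(1) by simp
  hence l2: "2 * l \<le> l'" using Suc.prems(2) by simp
  obtain c'' where c: "\<And>i. \<bar>c'' $ i - c' $ i\<bar> \<le> l' / 4" "\<And>i. \<bar>c $ i - c'' $ i\<bar> \<le> (l' / 2 - l) / 2"
    using intermediate_cube[OF Suc.prems(3) l2 Suc.prems(1)] by metis
  have "(LINT x:ccube c l|lebesgue. w x) \<le> \<rho> ^ k * (LINT x:ccube c'' (l' / 2)|lebesgue. w x)"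
    by (rule Suc.IH) (use Suc.prems c in auto)
  also have "\<dots> \<le> \<rho> ^ k * (\<rho> * (LINT x:ccube c' (2 * (l' / 2))|lebesgue. w x))"
  proof (intro mult_left_mono step)
    show "ccube c'' (l' / 2) \<subseteq> ccube c' (2 * (l' / 2))"
    proof
      fix x assume x: "x \<in> ccube c'' (l' / 2)"
      have "\<bar>x $ i - c' $ i\<bar> \<le> l' / 2" for i
        using c(1)[of i] x[unfolded mem_ccube, rule_format, of i] by argo
      thus "x \<in> ccube c' (2 * (l' / 2))" by (simp add: mem_ccube)
    qed
  qed (use \<rho> l2 Suc.prems in auto)
  finally show ?case by (simp add: mult_ac)
qed

lemma iterated_doubling:
  fixes c :: "real ^ 'n" and w :: "real ^ 'n \<Rightarrow> real"
  assumes step: "\<And>(c :: real ^ 'n) l. 0 < l \<Longrightarrow>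
      (LINT x:ccube c (2 * l)|lebesgue. w x) \<le> D * (LINT x:ccube c l|lebesgue. w x)"
    and D: "0 \<le> D" and l: "0 < l"
  shows "(LINT x:ccube c (2 ^ k * l)|lebesgue. w x) \<le> D ^ k * (LINT x:ccube c l|lebesgue. w x)"
proof (induction k)
  case (Suc k)
  have "(LINT x:ccube c (2 ^ Suc k * l)|lebesgue. w x) \<le> D * (LINT x:ccube c (2 ^ k * l)|lebesgue. w x)"
    using step[of "2 ^ k * l" c] l by (simp add: mult_ac)
  also have "\<dots> \<le> D * (D ^ k * (LINT x:ccube c l|lebesgue. w x))"
    by (rule mult_left_mono[OF Suc.IH D])
  finally show ?case by (simp add: mult_ac)
qed simp

lemma dyadic_exponent:
  fixes r :: real
  assumes "1 \<le> r"
  obtains k :: nat where "2 ^ k \<le> r" "r \<le> 2 ^ Suc k" "real k \<le> log 2 r" "log 2 r - 1 \<le> real k"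
proof -
  define k where "k = nat \<lfloor>log 2 r\<rfloor>"
  have 0: "0 \<le> log 2 r" using assms by simp
  hence k: "real k \<le> log 2 r" "log 2 r - 1 \<le> real k" "log 2 r \<le> real (Suc k)" unfolding k_def by linarith+
  have "2 powr real k \<le> r" using k(1) assms by (simp add: le_log_iff)
  moreover have "r \<le> 2 powr real (Suc k)" using k(3) assms by (simp add: log_le_iff)
  ultimately show ?thesis using that[of k] k by (simp add: powr_realpow del: of_nat_Suc power_Suc)
qed

text \<open>Both sides are exp (ln a ln r / ln 2). This turns a geometric factor over about
  \<open>log 2 r\<close> steps into a power of \<open>r\<close>.\<close>

lemma powr_log_swap: "0 < a \<Longrightarrow> 0 < r \<Longrightarrow> a powr log 2 r = r powr log 2 (a :: real)"
  by (simp add: powr_def log_def)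

lemma exp_log_Ainf_lower_growth:
  fixes K :: real
  assumes K: "0 < K"
  obtains C d where "0 < C" "0 \<le> d" "d < real CARD('n)"
    "\<And>w (Q :: (real ^ 'n) set) R. exp_log_Ainf K w \<Longrightarrow> is_cube Q \<Longrightarrow> is_cube R \<Longrightarrow> Q \<subseteq> R \<Longrightarrow>
      avg Q w \<le> C * (edge_length R / edge_length Q) powr d * avg R w"
proof -
  obtain \<rho> :: real where \<rho>: "1 / 2 \<le> \<rho>" "\<rho> < 1" and
    step: "\<And>w (c :: real ^ 'n) c' l. exp_log_Ainf K w \<Longrightarrow> 0 < l \<Longrightarrow> ccube c l \<subseteq> ccube c' (2 * l) \<Longrightarrow>
    (LINT x:ccube c l|lebesgue. w x) \<le> \<rho> * (LINT x:ccube c' (2 * l)|lebesgue. w x)"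
    using reverse_doubling[OF K] by metis
  \<comment> \<open>Passing from integrals to averages contributes r^n, and reverse doubling
    contributes \<open>r powr log 2 \<rho>\<close>. The strict bound d < n comes from \<rho> <
    1.\<close>
  define d where "d = real CARD('n) + log 2 \<rho>"
  have "log 2 \<rho> \<ge> -1" "log 2 \<rho> < 0" using \<rho> by (simp_all add: le_log_iff powr_minus_divide)
  moreover have "1 \<le> real CARD('n)" by (simp add: Suc_le_eq)
  ultimately have d: "0 \<le> d" "d < real CARD('n)" unfolding d_def by linarith+
  have main: "avg Q w \<le> (1 / \<rho>) * (edge_length R / edge_length Q) powr d * avg R w"
    if w: "exp_log_Ainf K w" and Q: "is_cube Q" and R: "is_cube R" and QR: "Q \<subseteq> R"
    for w and Q R :: "(real ^ 'n) set"
  proof -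
    note w' = exp_log_AinfD[OF w]
    define l l' c c' where "l = edge_length Q" and "l' = edge_length R" and "c = cube_center Q" and "c' = cube_center R"
    have at: "cube_at c l Q" "cube_at c' l' R" using cube_at_params Q R by (auto simp: l_def l'_def c_def c'_def)
    have l: "0 < l" "0 < l'" using at by (auto simp: cube_at_def)
    note co = cube_subset_coords[OF at QR]
    define r where "r = l' / l"
    have r: "1 \<le> r" using co(2) l by (simp add: r_def)
    obtain k :: nat where k: "2 ^ k \<le> r" "log 2 r - 1 \<le> real k" using dyadic_exponent[OF r] by metis
    have Rnn: "0 \<le> (LINT x:R|lebesgue. w x)"
      by (auto simp: set_lebesgue_integral_def w' intro!: Bochner_Integration.integral_nonneg)
    have "(LINT x:Q|lebesgue. w x) = (LINT x:ccube c l|lebesgue. w x)"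
      by (simp add: set_integral_closed_cube[OF at(1) w'(1)])
    also have "\<dots> \<le> \<rho> ^ k * (LINT x:ccube c' l'|lebesgue. w x)"
      by (rule iterated_reverse_doubling[OF step[OF w] w])
        (use \<rho> l k(1) co in \<open>auto simp: r_def pos_le_divide_eq\<close>)
    also have "(LINT x:ccube c' l'|lebesgue. w x) = (LINT x:R|lebesgue. w x)"
      by (rule set_integral_closed_cube[OF at(2) w'(1)])
    \<comment> \<open>As \<rho> < 1, the lower bound on \<open>k\<close> is the relevant one;
      rounding to an integer costs one factor 1/\<rho>.\<close>
    also have "\<rho> ^ k \<le> (1 / \<rho>) * r powr log 2 \<rho>"
    proof -
      have "\<rho> ^ k = \<rho> powr real k" using \<rho> by (simp add: powr_realpow)
      also have "\<dots> \<le> \<rho> powr (log 2 r - 1)" using k(2) \<rho> by (intro powr_mono') auto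
      also have "\<dots> = (1 / \<rho>) * \<rho> powr log 2 r" using \<rho> by (simp add: powr_diff)
      also have "\<rho> powr log 2 r = r powr log 2 \<rho>" using \<rho> r by (intro powr_log_swap) auto
      finally show ?thesis .
    qed
    finally have I: "(LINT x:Q|lebesgue. w x) \<le> (1 / \<rho>) * r powr log 2 \<rho> * (LINT x:R|lebesgue. w x)"
      using Rnn by (simp add: mult_right_mono)
    have "avg Q w = (LINT x:Q|lebesgue. w x) / l ^ CARD('n)" by (simp add: avg_def measure_cube[OF Q] l_def)
    also have "\<dots> \<le> (1 / \<rho>) * r powr log 2 \<rho> * (LINT x:R|lebesgue. w x) / l ^ CARD('n)"
      using I l by (intro divide_right_mono) auto
    also have "\<dots> = (1 / \<rho>) * (r powr log 2 \<rho> * r ^ CARD('n)) * ((LINT x:R|lebesgue. w x) / l' ^ CARD('n))"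
      using l by (simp add: r_def power_divide)
    also have "r powr log 2 \<rho> * r ^ CARD('n) = r powr d"
      using r by (simp add: d_def powr_add powr_realpow mult.commute)
    also have "(LINT x:R|lebesgue. w x) / l' ^ CARD('n) = avg R w" by (simp add: avg_def measure_cube[OF R] l'_def)
    finally show ?thesis by (simp add: r_def l_def l'_def)
  qed
  show ?thesis by (rule that[of "1 / \<rho>" d]) (use main d \<rho> in auto)
qed

lemma exp_log_Ainf_upper_growth:
  fixes K :: real
  assumes K: "0 < K"
  obtains C d where "0 < C" "0 \<le> d"
    "\<And>w (Q :: (real ^ 'n) set) s. exp_log_Ainf K w \<Longrightarrow> is_cube Q \<Longrightarrow> 1 \<le> s \<Longrightarrow>
      avg (dilate s Q) w \<le> C * s powr d * avg Q w"
proof -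
  obtain D where D: "1 \<le> D" and step: "\<And>w (c :: real ^ 'n) l. exp_log_Ainf K w \<Longrightarrow> 0 < l \<Longrightarrow>
    (LINT x:ccube c (2 * l)|lebesgue. w x) \<le> D * (LINT x:ccube c l|lebesgue. w x)"
    using doubling[OF K] by metis
  have main: "avg (dilate s Q) w \<le> D * s powr log 2 D * avg Q w"
    if w: "exp_log_Ainf K w" and Q: "is_cube Q" and s: "1 \<le> s"
    for w and Q :: "(real ^ 'n) set" and s
  proof -
    note w' = exp_log_AinfD[OF w]
    define l c where "l = edge_length Q" and "c = cube_center Q"
    have at: "cube_at c l Q" using cube_at_params Q by (auto simp: l_def c_def)
    have l: "0 < l" using at by (auto simp: cube_at_def)
    have atS: "cube_at c (s * l) (dilate s Q)" by (rule dilate_cube_at[OF at]) (use s in auto)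
    hence S: "is_cube (dilate s Q)" unfolding is_cube_def by blast
    obtain k :: nat where k: "s \<le> 2 ^ Suc k" "real k \<le> log 2 s" using dyadic_exponent[OF s] by metis
    have Qnn: "0 \<le> (LINT x:Q|lebesgue. w x)"
      by (auto simp: set_lebesgue_integral_def w' intro!: Bochner_Integration.integral_nonneg)
    have "s * l \<le> 2 ^ Suc k * l" using k(1) l by (intro mult_right_mono) auto
    hence "ccube c (s * l) \<subseteq> ccube c (2 ^ Suc k * l)" by (rule ccube_mono)
    hence "dilate s Q \<subseteq> ccube c (2 ^ Suc k * l)" using cube_at_null_diff(1)[OF atS] by blast
    hence "(LINT x:dilate s Q|lebesgue. w x) \<le> (LINT x:ccube c (2 ^ Suc k * l)|lebesgue. w x)"
      using l by (intro set_integral_mono_set_nonneg w' cube_sets_lebesgue S is_cube_ccube) auto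
    also have "\<dots> \<le> D ^ Suc k * (LINT x:ccube c l|lebesgue. w x)"
      using D by (intro iterated_doubling step w l) auto
    also have "(LINT x:ccube c l|lebesgue. w x) = (LINT x:Q|lebesgue. w x)"
      by (rule set_integral_closed_cube[OF at w'(1)])
    \<comment> \<open>As D \<ge> 1, the upper bound on \<open>k\<close> is the relevant one;
      covering the dilate takes one step more, which costs a factor \<open>D\<close>.\<close>
    also have "D ^ Suc k \<le> D * s powr log 2 D"
    proof -
      have "D ^ Suc k = D * D powr real k" using D by (simp add: powr_realpow)
      also have "\<dots> \<le> D * D powr log 2 s" using k(2) D by (intro mult_left_mono powr_mono) auto
      also have "D powr log 2 s = s powr log 2 D" using D s by (intro powr_log_swap) auto
      finally show ?thesis .
    qed
    finally have I: "(LINT x:dilate s Q|lebesgue. w x) \<le> D * s powr log 2 D * (LINT x:Q|lebesgue. w x)"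
      using Qnn by (simp add: mult_right_mono)
    have "avg (dilate s Q) w = (LINT x:dilate s Q|lebesgue. w x) / (s * l) ^ CARD('n)"
      by (simp add: avg_def measure_cube[OF S] edge_length_eq[OF atS])
    also have "\<dots> \<le> (D * s powr log 2 D * (LINT x:Q|lebesgue. w x)) / (s * l) ^ CARD('n)"
      using I l s by (intro divide_right_mono) auto
    \<comment> \<open>The gain s^n from the larger volume is discarded; the existence of some
      exponent is all that is sought.\<close>
    also have "\<dots> \<le> (D * s powr log 2 D * (LINT x:Q|lebesgue. w x)) / l ^ CARD('n)"
      using l s D Qnn by (intro divide_left_mono power_mono) (auto simp: mult_ge1_I)
    also have "\<dots> = D * s powr log 2 D * avg Q w" by (simp add: avg_def measure_cube[OF Q] l_def)
    finally show ?thesis .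
  qed
  show ?thesis by (rule that[of D "log 2 D"]) (use main D in auto)
qed

section \<open>Matrix weights with reducing operators\<close>

lemma op_norm_powr_leI:
  assumes p: "0 < p" and c: "0 \<le> c" and le: "\<And>z. norm (B *v z) powr p \<le> c * norm z powr p"
  shows "op_norm B powr p \<le> c"
proof -
  have "op_norm B \<le> c powr (1 / p)"
  proof (rule op_norm_leI)
    fix z
    have "norm (B *v z) = (norm (B *v z) powr p) powr (1 / p)" using p by (simp add: powr_powr)
    also have "\<dots> \<le> (c * norm z powr p) powr (1 / p)" using le p by (intro powr_mono2) auto
    also have "\<dots> = c powr (1 / p) * norm z" using c p by (simp add: powr_mult powr_powr)
    finally show "norm (B *v z) \<le> c powr (1 / p) * norm z" .
  qed
  hence "op_norm B powr p \<le> (c powr (1 / p)) powr p" using p by (intro powr_mono2) auto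
  thus ?thesis using p c by (simp add: powr_powr)
qed

lemma norm_axis_one [simp]: "norm (axis j 1 :: complex ^ 'm) = 1"
  by (simp add: norm_vec_def L2_set_def axis_def if_distrib[of norm] if_distrib[of "\<lambda>x. x\<^sup>2"] cong: if_cong)

lemma set_integrable_sum:
  fixes f :: "'i \<Rightarrow> 'a \<Rightarrow> real"
  shows "(\<And>i. i \<in> I \<Longrightarrow> set_integrable N E (f i)) \<Longrightarrow> set_integrable N E (\<lambda>x. \<Sum>i\<in>I. f i x)"
  unfolding set_integrable_def scaleR_sum_right by (rule Bochner_Integration.integrable_sum)

text \<open>Some term is at least the mean, so the sum is at most the number of terms times that
  one. This argument covers p < 1 as well as p \<ge> 1.\<close>

lemma sum_powr_le:
  fixes t :: "'m::finite \<Rightarrow> real"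
  assumes "0 < p" "\<And>j. 0 \<le> t j"
  shows "(\<Sum>j\<in>UNIV. t j) powr p \<le> real CARD('m) powr p * (\<Sum>j\<in>UNIV. t j powr p)"
proof -
  have "\<exists>j. (\<Sum>j\<in>UNIV. t j) \<le> real CARD('m) * t j"
  proof (rule ccontr)
    assume "\<nexists>j. (\<Sum>j\<in>UNIV. t j) \<le> real CARD('m) * t j"
    hence "(\<Sum>i\<in>(UNIV::'m set). real CARD('m) * t i) < (\<Sum>i\<in>(UNIV::'m set). \<Sum>j\<in>UNIV. t j)"
      by (intro sum_strict_mono) (auto simp: not_le)
    thus False by (simp add: sum_distrib_left)
  qed
  then obtain j where "(\<Sum>j\<in>UNIV. t j) \<le> real CARD('m) * t j" by blast
  hence "(\<Sum>j\<in>UNIV. t j) powr p \<le> (real CARD('m) * t j) powr p"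
    using assms by (intro powr_mono2) (auto intro: sum_nonneg)
  also have "\<dots> = real CARD('m) powr p * t j powr p" using assms by (simp add: powr_mult)
  also have "\<dots> \<le> real CARD('m) powr p * (\<Sum>j\<in>UNIV. t j powr p)"
    by (intro mult_left_mono member_le_sum) auto
  finally show ?thesis .
qed

lemma pos_definite_inverse:
  assumes "pos_definite A"
  shows "A ** matrix_inv A = mat 1" "matrix_inv A ** A = mat 1"
proof -
  have "z = 0" if "A *v z = 0" for z
  proof (rule ccontr)
    assume "z \<noteq> 0"
    hence "0 < Re (herm_form A z)" using assms by (simp add: pos_definite_def)
    thus False by (simp add: herm_form_def that)
  qed
  hence "invertible A" using matrix_left_invertible_ker invertible_left_inverse by blast
  thus "A ** matrix_inv A = mat 1" "matrix_inv A ** A = mat 1"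
    unfolding invertible_def matrix_inv_def by (metis (mono_tags, lifting) someI_ex)+
qed

text \<open>Integrability on balls makes the truncated entries measurable; the entries are their
  pointwise limits.\<close>

lemma matrix_weight_measurable:
  fixes W :: "real ^ 'n \<Rightarrow> complex ^ 'm ^ 'm"
  assumes "matrix_weight W"
  shows "W \<in> borel_measurable lebesgue"
proof -
  have entry: "(\<lambda>x. W x $ i $ j) \<in> borel_measurable lebesgue" for i j
  proof (rule borel_measurable_LIMSEQ_metric)
    fix k :: nat
    show "(\<lambda>x. indicator (cball 0 (real k)) x *\<^sub>R W x $ i $ j) \<in> borel_measurable lebesgue"
      using assms unfolding matrix_weight_def set_integrable_def
      by (intro borel_measurable_integrable) auto
  next
    fix x :: "real ^ 'n"
    obtain n where "norm x \<le> real n" using real_arch_simple by blast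
    hence "\<forall>k\<ge>n. indicator (cball 0 (real k)) x *\<^sub>R W x $ i $ j = W x $ i $ j" by (auto simp: indicator_def)
    hence "\<forall>\<^sub>F k in sequentially. indicator (cball 0 (real k)) x *\<^sub>R W x $ i $ j = W x $ i $ j"
      unfolding eventually_sequentially by blast
    thus "(\<lambda>k. indicator (cball 0 (real k)) x *\<^sub>R W x $ i $ j) \<longlonglongrightarrow> W x $ i $ j"
      by (rule tendsto_eventually)
  qed
  show ?thesis
  proof (subst borel_measurable_euclidean_space, intro ballI)
    fix e :: "complex ^ 'm ^ 'm" assume "e \<in> Basis"
    then obtain i j u where "e = axis i (axis j u)" by (auto simp: Basis_vec_def)
    hence "(\<lambda>x. W x \<bullet> e) = (\<lambda>x. W x $ i $ j \<bullet> u)" by (simp add: inner_axis)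
    thus "(\<lambda>x. W x \<bullet> e) \<in> borel_measurable lebesgue" using entry by simp
  qed
qed

section \<open>Weights with fixed reducing operators and explicit constants\<close>

locale reduced_matrix_weight =
  fixes p a b K :: real
    and W :: "real ^ 'n \<Rightarrow> complex ^ 'm ^ 'm"
    and A :: "(real ^ 'n) set \<Rightarrow> complex ^ 'm ^ 'm"
  assumes p: "0 < p" and W: "matrix_weight W"
    and log_plus: "is_cube Q \<Longrightarrow> set_integrable lebesgue Q (\<lambda>y. max 0 (ln (inner_avg p W Q y)))"
    and K: "is_cube Q \<Longrightarrow> log_mean p W Q Q \<le> K"
    and ab: "0 < a" "0 < b"
    and pd: "is_cube Q \<Longrightarrow> pos_definite (A Q)"
    and red_lower: "is_cube Q \<Longrightarrow>
      a * (avg Q (\<lambda>x. norm (mat_powr (W x) (1 / p) *v z) powr p)) powr (1 / p) \<le> norm (A Q *v z)"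
    and red_upper: "is_cube Q \<Longrightarrow>
      norm (A Q *v z) \<le> b * (avg Q (\<lambda>x. norm (mat_powr (W x) (1 / p) *v z) powr p)) powr (1 / p)"
begin

definition V :: "real ^ 'n \<Rightarrow> complex ^ 'm ^ 'm" where "V x = mat_powr (W x) (1 / p)"
definition M :: "real ^ 'n \<Rightarrow> complex ^ 'm ^ 'm" where "M y = mat_powr (W y) (- 1 / p)"
definition w :: "complex ^ 'm \<Rightarrow> real ^ 'n \<Rightarrow> real" where "w z x = norm (V x *v z) powr p"
text \<open>At \<open>N = M y\<close> this is the inner average at \<open>y\<close>. A general
  \<open>N\<close> permits continuity in \<open>N\<close>, and the choice
  \<open>N = matrix_inv (A R)\<close>.\<close>

definition G :: "(real ^ 'n) set \<Rightarrow> complex ^ 'm ^ 'm \<Rightarrow> real" where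
  "G Q N = avg Q (\<lambda>x. op_norm (V x ** N) powr p)"
text \<open>Stands in for the logarithm of the inner average, from which it differs almost
  everywhere by an amount between \<open>ln c1\<close> and \<open>ln c2\<close>. Unlike that
  average, it is easy to compare for two cubes.\<close>

definition lam :: "(real ^ 'n) set \<Rightarrow> real ^ 'n \<Rightarrow> real" where
  "lam Q y = ln (op_norm (A Q ** M y) powr p)"
definition c1 :: real where "c1 = b powr (- p)"
definition c2 :: real where "c2 = real CARD('m) powr p * real CARD('m) * a powr (- p)"

lemma c_pos: "0 < c1" "0 < c2"
  using ab by (simp_all add: c1_def c2_def)

lemma nonneg_W: "nonneg_definite (W x)"
  using W by (simp add: matrix_weight_def)

lemma V_measurable [measurable]: "V \<in> borel_measurable lebesgue"
  and M_measurable [measurable]: "M \<in> borel_measurable lebesgue"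
  unfolding V_def[abs_def] M_def[abs_def]
  by (intro borel_measurable_mat_powr matrix_weight_measurable W nonneg_W)+

lemma op_norm_measurable [measurable (raw)]:
  "f \<in> borel_measurable N \<Longrightarrow> (\<lambda>x. op_norm (f x)) \<in> borel_measurable N"
  by (rule borel_measurable_continuous_on[where f = op_norm]) (intro continuous_intros)

lemma mult_right_measurable [measurable (raw)]:
  fixes f :: "'x \<Rightarrow> complex ^ 'm ^ 'm" and B :: "complex ^ 'm ^ 'm"
  shows "f \<in> borel_measurable N \<Longrightarrow> (\<lambda>x. f x ** B) \<in> borel_measurable N"
  by (rule borel_measurable_continuous_on[where f = "\<lambda>y. y ** B"]) (intro continuous_intros)

lemma mult_left_measurable [measurable (raw)]:
  fixes f :: "'x \<Rightarrow> complex ^ 'm ^ 'm" and B :: "complex ^ 'm ^ 'm"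
  shows "f \<in> borel_measurable N \<Longrightarrow> (\<lambda>x. B ** f x) \<in> borel_measurable N"
  by (rule borel_measurable_continuous_on[where f = "\<lambda>y. B ** y"]) (intro continuous_intros)

lemma AE_inverse: "AE x in lebesgue. V x ** M x = mat 1 \<and> M x ** V x = mat 1"
proof -
  have "AE x in lebesgue. invertible (W x)" using W by (simp add: matrix_weight_def)
  thus ?thesis
  proof eventually_elim
    case (elim x)
    have "V x ** M x = mat 1"
      unfolding V_def M_def using mat_powr_mult_uminus[OF nonneg_W elim, of "1 / p"] by simp
    thus ?case using matrix_left_right_inverse by blast
  qed
qed

lemma A_inverse:
  assumes "is_cube Q"
  shows "A Q ** matrix_inv (A Q) = mat 1" "matrix_inv (A Q) ** A Q = mat 1"
  using pos_definite_inverse[OF pd[OF assms]] by blast+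

section \<open>Integrability of the matrix norms and of the scalar weights\<close>

lemma integrable_V:
  assumes "is_cube Q"
  shows "set_integrable lebesgue Q (\<lambda>x. op_norm (V x) powr p)"
proof (rule set_integrable_bound)
  \<comment> \<open>The diagonal entries dominate because they bound the trace, which bounds
    \<open>op_norm (V x) powr p\<close>.\<close>
  show "set_integrable lebesgue Q (\<lambda>x. \<Sum>i\<in>UNIV. norm (W x $ i $ i))"
  proof -
    have "set_integrable lebesgue Q (\<lambda>x. norm (W x $ i $ i))" for i
    proof (rule set_integrable_subset)
      let ?C = "ccube (cube_center Q) (edge_length Q)"
      have "set_integrable lebesgue ?C (\<lambda>x. W x $ i $ i)"
        using W unfolding matrix_weight_def ccube_def by (meson compact_cbox)
      thus "set_integrable lebesgue ?C (\<lambda>x. norm (W x $ i $ i))" by (rule set_integrable_norm)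
      show "Q \<subseteq> ?C" by (rule cube_at_null_diff[OF cube_at_params[OF assms]])
    qed (rule cube_sets_lebesgue[OF assms])
    thus ?thesis by (rule set_integrable_sum)
  qed
  show "set_borel_measurable lebesgue Q (\<lambda>x. op_norm (V x) powr p)"
    by (intro set_borel_measurable_lebesgue cube_sets_lebesgue assms) measurable
  have "norm (op_norm (V x) powr p) \<le> norm (\<Sum>i\<in>UNIV. norm (W x $ i $ i))" for x
  proof -
    have "op_norm (V x) powr p \<le> Re (trace (W x))"
      unfolding V_def by (rule op_norm_mat_powr_le_trace[OF nonneg_W p])
    also have "\<dots> \<le> norm (trace (W x))" by (rule complex_Re_le_cmod)
    also have "\<dots> \<le> (\<Sum>i\<in>UNIV. norm (W x $ i $ i))" unfolding trace_def by (rule norm_sum)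
    finally show ?thesis by (simp add: sum_nonneg)
  qed
  thus "AE x in lebesgue. x \<in> Q \<longrightarrow> norm (op_norm (V x) powr p) \<le> norm (\<Sum>i\<in>UNIV. norm (W x $ i $ i))"
    by simp
qed

lemma op_norm_mult_powr: "op_norm (B ** N) powr p \<le> op_norm B powr p * op_norm N powr p"
  using p op_norm_mult[of B N] by (simp flip: powr_mult add: powr_mono2)

lemma integrable_VN:
  assumes "is_cube Q"
  shows "set_integrable lebesgue Q (\<lambda>x. op_norm (V x ** N) powr p)"
proof (rule set_integrable_bound)
  show "set_integrable lebesgue Q (\<lambda>x. op_norm N powr p * op_norm (V x) powr p)"
    by (intro set_integrable_mult_right integrable_V assms)
  show "set_borel_measurable lebesgue Q (\<lambda>x. op_norm (V x ** N) powr p)"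
    by (intro set_borel_measurable_lebesgue cube_sets_lebesgue assms) measurable
  have "op_norm (V x ** N) powr p \<le> op_norm N powr p * op_norm (V x) powr p" for x
    using op_norm_mult_powr[of "V x" N] by (simp add: mult.commute)
  thus "AE x in lebesgue. x \<in> Q \<longrightarrow>
      norm (op_norm (V x ** N) powr p) \<le> norm (op_norm N powr p * op_norm (V x) powr p)"
    by simp
qed

lemma w_measurable: "w z \<in> borel_measurable lebesgue"
proof -
  have "(\<lambda>x. norm (V x *v z)) \<in> borel_measurable lebesgue"
  proof (rule borel_measurable_continuous_on[where f = "\<lambda>B. norm (B *v z)"])
    show "continuous_on UNIV (\<lambda>B :: complex ^ 'm ^ 'm. norm (B *v z))"
      unfolding matrix_vector_mult_def by (intro continuous_intros)
  qed measurable
  thus ?thesis unfolding w_def[abs_def] by measurable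
qed

lemma w_nonneg: "0 \<le> w z x" by (simp add: w_def)

lemma w_pos: "z \<noteq> 0 \<Longrightarrow> AE x in lebesgue. 0 < w z x"
  using AE_inverse
proof eventually_elim
  case (elim x)
  have "V x *v z \<noteq> 0"
  proof
    assume "V x *v z = 0"
    hence "(M x ** V x) *v z = 0" by (simp flip: matrix_vector_mul_assoc)
    thus False using elim by simp
  qed
  thus ?case by (simp add: w_def)
qed

lemma integrable_w:
  assumes "is_cube Q"
  shows "set_integrable lebesgue Q (w z)"
proof (rule set_integrable_bound)
  show "set_integrable lebesgue Q (\<lambda>x. norm z powr p * op_norm (V x) powr p)"
    by (intro set_integrable_mult_right integrable_V assms)
  show "set_borel_measurable lebesgue Q (w z)"
    by (intro set_borel_measurable_lebesgue cube_sets_lebesgue assms w_measurable)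
  have "w z x \<le> norm z powr p * op_norm (V x) powr p" for x
    unfolding w_def using op_norm_bound[of "V x" z] p
    by (simp flip: powr_mult add: powr_mono2 mult.commute)
  thus "AE x in lebesgue. x \<in> Q \<longrightarrow> norm (w z x) \<le> norm (norm z powr p * op_norm (V x) powr p)"
    by (simp add: w_nonneg)
qed

lemma avg_w_bounds:
  assumes "is_cube Q"
  shows "avg Q (w z) \<le> a powr (- p) * norm (A Q *v z) powr p"
    and "norm (A Q *v z) powr p \<le> b powr p * avg Q (w z)"
proof -
  have nn: "0 \<le> avg Q (w z)" by (intro avg_nonneg w_nonneg)
  have l: "a * avg Q (w z) powr (1 / p) \<le> norm (A Q *v z)"
    and u: "norm (A Q *v z) \<le> b * avg Q (w z) powr (1 / p)"
    using red_lower[OF assms, of z] red_upper[OF assms, of z] by (simp_all add: w_def[abs_def] V_def)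
  have "(a * avg Q (w z) powr (1 / p)) powr p \<le> norm (A Q *v z) powr p"
    using l ab p by (intro powr_mono2) auto
  hence "a powr p * avg Q (w z) \<le> norm (A Q *v z) powr p"
    using nn ab p by (simp add: powr_mult powr_powr)
  thus "avg Q (w z) \<le> a powr (- p) * norm (A Q *v z) powr p"
    using ab by (simp add: powr_minus_divide field_simps)
  have "norm (A Q *v z) powr p \<le> (b * avg Q (w z) powr (1 / p)) powr p"
    using u ab p by (intro powr_mono2) auto
  thus "norm (A Q *v z) powr p \<le> b powr p * avg Q (w z)"
    using nn ab p by (simp add: powr_mult powr_powr)
qed

section \<open>Inner averages expressed through reducing operators\<close>

lemma inner_avg_G: "inner_avg p W Q y = G Q (M y)"
  by (simp add: inner_avg_def G_def V_def M_def)

text \<open>For each vector z the reducing inequality is applied at N z, and the norm of V(x) N z is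
  bounded inside the average by the operator norm.\<close>

lemma G_lower:
  assumes "is_cube Q"
  shows "c1 * op_norm (A Q ** N) powr p \<le> G Q N"
proof -
  have nn: "0 \<le> G Q N" unfolding G_def by (intro avg_nonneg) simp
  have "op_norm (A Q ** N) powr p \<le> b powr p * G Q N"
  proof (rule op_norm_powr_leI[OF p])
    fix z
    have "norm ((A Q ** N) *v z) powr p \<le> b powr p * avg Q (w (N *v z))"
      using avg_w_bounds(2)[OF assms, of "N *v z"] by (simp add: matrix_vector_mul_assoc)
    moreover have "avg Q (w (N *v z)) \<le> avg Q (\<lambda>x. norm z powr p * op_norm (V x ** N) powr p)"
    proof (rule avg_mono_AE)
      have "w (N *v z) x \<le> norm z powr p * op_norm (V x ** N) powr p" for x
        unfolding w_def matrix_vector_mul_assoc using op_norm_bound[of "V x ** N" z] p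
        by (simp flip: powr_mult add: powr_mono2 mult.commute)
      thus "AE x in lebesgue. w (N *v z) x \<le> norm z powr p * op_norm (V x ** N) powr p" by simp
    qed (intro integrable_w set_integrable_mult_right integrable_VN assms)+
    hence "b powr p * avg Q (w (N *v z)) \<le> b powr p * (norm z powr p * G Q N)"
      unfolding avg_cmult G_def by (rule mult_left_mono) simp
    ultimately show "norm ((A Q ** N) *v z) powr p \<le> b powr p * G Q N * norm z powr p"
      by (simp add: mult_ac)
  qed (use nn in simp)
  thus ?thesis using ab by (simp add: c1_def powr_minus_divide field_simps)
qed

text \<open>Only the images of the basis vectors have to be averaged. Summing over m columns inside
  the p-th power produces the two dimension factors in \<open>c2\<close>.\<close>

lemma G_upper:
  assumes "is_cube Q"
  shows "G Q N \<le> c2 * op_norm (A Q ** N) powr p"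
proof -
  let ?m = "real CARD('m)"
  have "G Q N \<le> avg Q (\<lambda>x. ?m powr p * (\<Sum>j\<in>UNIV. w (N *v axis j 1) x))"
    unfolding G_def
  proof (rule avg_mono_AE)
    have "op_norm (V x ** N) powr p \<le> ?m powr p * (\<Sum>j\<in>UNIV. w (N *v axis j 1) x)" for x
    proof -
      have "op_norm (V x ** N) powr p \<le> (\<Sum>j\<in>UNIV. norm ((V x ** N) *v axis j 1)) powr p"
        using p by (intro powr_mono2 op_norm_le_columns) auto
      also have "\<dots> \<le> ?m powr p * (\<Sum>j\<in>UNIV. norm ((V x ** N) *v axis j 1) powr p)"
        by (rule sum_powr_le[OF p]) simp
      finally show ?thesis by (simp add: w_def matrix_vector_mul_assoc)
    qed
    thus "AE x in lebesgue. op_norm (V x ** N) powr p \<le> ?m powr p * (\<Sum>j\<in>UNIV. w (N *v axis j 1) x)"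
      by simp
    have "set_integrable lebesgue Q (\<lambda>x. \<Sum>j\<in>UNIV. w (N *v axis j 1) x)"
      by (intro set_integrable_sum integrable_w assms)
    thus "set_integrable lebesgue Q (\<lambda>x. ?m powr p * (\<Sum>j\<in>UNIV. w (N *v axis j 1) x))"
      by (intro set_integrable_mult_right)
  qed (rule integrable_VN[OF assms])
  also have "\<dots> = ?m powr p * (\<Sum>j\<in>UNIV. avg Q (w (N *v axis j 1)))"
    by (simp add: avg_cmult avg_sum integrable_w[OF assms])
  also have "\<dots> \<le> ?m powr p * (\<Sum>j\<in>(UNIV::'m set). a powr (- p) * op_norm (A Q ** N) powr p)"
  proof (intro mult_left_mono sum_mono)
    fix j :: 'm
    have "avg Q (w (N *v axis j 1)) \<le> a powr (- p) * norm ((A Q ** N) *v axis j 1) powr p"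
      using avg_w_bounds(1)[OF assms] by (simp flip: matrix_vector_mul_assoc)
    also have "\<dots> \<le> a powr (- p) * op_norm (A Q ** N) powr p"
      using op_norm_bound[of "A Q ** N" "axis j 1"] p by (intro mult_left_mono powr_mono2) auto
    finally show "avg Q (w (N *v axis j 1)) \<le> a powr (- p) * op_norm (A Q ** N) powr p" .
  qed simp
  finally show ?thesis by (simp add: c2_def)
qed

text \<open>Dominated convergence: a convergent sequence of matrices is bounded, so a multiple of
  the p-th power of the norm of \<open>V\<close> dominates. Composed with \<open>M\<close>, this
  makes the inner average measurable in \<open>y\<close>.\<close>

lemma continuous_G:
  assumes Q: "is_cube Q"
  shows "continuous_on UNIV (G Q)"
  unfolding continuous_on_sequentially
proof (intro allI ballI impI, elim conjE)
  fix N :: "nat \<Rightarrow> complex ^ 'm ^ 'm" and N' assume lim: "N \<longlonglongrightarrow> N'"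
  have cont: "continuous_on UNIV (op_norm :: complex ^ 'm ^ 'm \<Rightarrow> real)"
    by (intro continuous_intros)
  have limo: "(\<lambda>k. op_norm (N k)) \<longlonglongrightarrow> op_norm N'"
    by (rule continuous_on_tendsto_compose[OF cont lim]) auto
  then obtain B where B: "\<And>k. norm (op_norm (N k)) \<le> B"
    by (meson BseqE convergent_imp_Bseq convergentI)
  have "(\<lambda>k. LINT x|lebesgue. indicator Q x *\<^sub>R op_norm (V x ** N k) powr p)
    \<longlonglongrightarrow> (LINT x|lebesgue. indicator Q x *\<^sub>R op_norm (V x ** N') powr p)"
  proof (rule integral_dominated_convergence)
    show "(\<lambda>x. indicator Q x *\<^sub>R op_norm (V x ** N') powr p) \<in> borel_measurable lebesgue"
      "\<And>k. (\<lambda>x. indicator Q x *\<^sub>R op_norm (V x ** N k) powr p) \<in> borel_measurable lebesgue"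
      using integrable_VN[OF Q] unfolding set_integrable_def by auto
    show "integrable lebesgue (\<lambda>x. indicator Q x *\<^sub>R (B powr p * op_norm (V x) powr p))"
      using set_integrable_mult_right[OF integrable_V[OF Q], of "B powr p"]
      unfolding set_integrable_def by blast
    have "(\<lambda>k. op_norm (V x ** N k)) \<longlonglongrightarrow> op_norm (V x ** N')" for x
    proof -
      have "continuous_on UNIV (\<lambda>N. op_norm (V x ** N))" by (intro continuous_intros)
      from continuous_on_tendsto_compose[OF this lim] show ?thesis by auto
    qed
    thus "AE x in lebesgue. (\<lambda>k. indicator Q x *\<^sub>R op_norm (V x ** N k) powr p)
        \<longlonglongrightarrow> indicator Q x *\<^sub>R op_norm (V x ** N') powr p"
      using p by (intro AE_I2 tendsto_intros tendsto_powr') auto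
    fix k
    have "op_norm (V x ** N k) powr p \<le> B powr p * op_norm (V x) powr p" for x
    proof -
      have "op_norm (V x ** N k) powr p \<le> op_norm (V x) powr p * op_norm (N k) powr p"
        by (rule op_norm_mult_powr)
      also have "\<dots> \<le> op_norm (V x) powr p * B powr p"
        using B[of k] p by (intro mult_left_mono powr_mono2) auto
      finally show ?thesis by (simp add: mult.commute)
    qed
    thus "AE x in lebesgue. norm (indicator Q x *\<^sub>R op_norm (V x ** N k) powr p)
        \<le> indicator Q x *\<^sub>R (B powr p * op_norm (V x) powr p)"
      by (auto simp: indicator_def)
  qed
  thus "(G Q \<circ> N) \<longlonglongrightarrow> G Q N'"
    unfolding comp_def G_def avg_def set_lebesgue_integral_def
    by (intro tendsto_divide) (use measure_cube_pos[OF Q] in auto)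
qed

lemma inner_avg_measurable:
  assumes "is_cube Q"
  shows "inner_avg p W Q \<in> borel_measurable lebesgue"
  unfolding inner_avg_G[abs_def]
  by (rule borel_measurable_continuous_on[OF continuous_G[OF assms]]) measurable

section \<open>The logarithm of the inner average and its integrability\<close>

lemma lam_measurable: "lam Q \<in> borel_measurable lebesgue"
  unfolding lam_def[abs_def] by measurable

lemma AE_facts:
  assumes "is_cube Q"
  shows "AE y in lebesgue. V y ** M y = mat 1 \<and> M y ** V y = mat 1 \<and> 0 < op_norm (A Q ** M y) \<and>
    ln c1 + lam Q y \<le> ln (inner_avg p W Q y) \<and> ln (inner_avg p W Q y) \<le> ln c2 + lam Q y"
  using AE_inverse
proof eventually_elim
  case (elim y)
  \<comment> \<open>Positivity must precede any logarithm. Both factors are invertible here, so a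
    zero product would make the identity matrix zero.\<close>
  have "A Q ** M y \<noteq> 0"
  proof
    assume "A Q ** M y = 0"
    hence "matrix_inv (A Q) ** (A Q ** M y) ** V y = 0" by (simp add: matrix_matrix_mult_def vec_eq_iff)
    hence "mat 1 = (0 :: complex ^ 'm ^ 'm)"
      using elim A_inverse[OF assms] by (simp add: matrix_mul_assoc)
    thus False using op_norm_mat_1[where 'm = 'm] op_norm_leI[of "0 :: complex^'m^'m" 0] by auto
  qed
  hence pos: "0 < op_norm (A Q ** M y)" by (rule op_norm_pos)
  hence pos': "0 < op_norm (A Q ** M y) powr p" by simp
  have lo: "c1 * op_norm (A Q ** M y) powr p \<le> inner_avg p W Q y"
    and up: "inner_avg p W Q y \<le> c2 * op_norm (A Q ** M y) powr p"
    using G_lower[OF assms] G_upper[OF assms] by (simp_all add: inner_avg_G)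
  have "0 < c1 * op_norm (A Q ** M y) powr p" using pos' c_pos by simp
  hence i: "0 < inner_avg p W Q y" using lo by linarith
  have "ln (c1 * op_norm (A Q ** M y) powr p) \<le> ln (inner_avg p W Q y)"
    using lo i \<open>0 < c1 * _\<close> by (subst ln_le_cancel_iff) auto
  moreover have "ln (inner_avg p W Q y) \<le> ln (c2 * op_norm (A Q ** M y) powr p)"
    using up i by (subst ln_le_cancel_iff) auto
  ultimately show ?case
    using elim pos pos' c_pos by (simp add: ln_mult_pos lam_def)
qed

lemma mult_mat_one: "B ** C = mat 1 \<Longrightarrow> X ** B ** (C ** Y) = X ** (Y :: complex ^ 'm ^ 'm)"
  by (metis matrix_mul_assoc matrix_mul_rid)

lemma ln_powr_op_norm_mult_le:
  assumes "C = B ** N" "0 < op_norm C"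
  shows "0 < op_norm B" "0 < op_norm N"
    "ln (op_norm C powr p) \<le> ln (op_norm B powr p) + ln (op_norm N powr p)"
proof -
  have le: "op_norm C \<le> op_norm B * op_norm N" using op_norm_mult[of B N] assms(1) by simp
  hence "0 < op_norm B * op_norm N" using assms(2) by linarith
  thus pos: "0 < op_norm B" "0 < op_norm N"
    using op_norm_nonneg[of B] op_norm_nonneg[of N] by (auto simp: zero_less_mult_iff)
  have "ln (op_norm C) \<le> ln (op_norm B) + ln (op_norm N)"
    using le assms(2) pos by (simp flip: ln_mult_pos)
  thus "ln (op_norm C powr p) \<le> ln (op_norm B powr p) + ln (op_norm N powr p)"
    using p pos assms(2) by (simp add: ln_powr flip: distrib_left)
qed

text \<open>Inserting the inverse of \<open>A R\<close> and \<open>A R\<close> itself bounds the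
  difference of the logarithms by a number independent of \<open>y\<close>.\<close>

lemma lam_shift:
  assumes Q: "is_cube Q" and R: "is_cube R"
  shows "AE y in lebesgue. lam Q y \<le> ln (op_norm (A Q ** matrix_inv (A R)) powr p) + lam R y"
  using AE_facts[OF Q]
proof eventually_elim
  case (elim y)
  have "A Q ** M y = (A Q ** matrix_inv (A R)) ** (A R ** M y)"
    by (simp add: mult_mat_one A_inverse[OF R])
  from ln_powr_op_norm_mult_le(3)[OF this] show ?case using elim unfolding lam_def by blast
qed

text \<open>Inserting \<open>M y\<close> and \<open>V y\<close> splits the norm, and ln t \<le> t
  replaces one logarithm by an integrable term. \<open>C\<close> is left free: \<open>A R\<close>
  gives integrability of \<open>lam R\<close>, and \<open>A Q\<close> the comparison of two
  cubes.\<close>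

lemma lam_lower:
  assumes R: "is_cube R" and C: "0 < op_norm (C ** matrix_inv (A R))"
  shows "AE y in lebesgue. ln (op_norm (C ** matrix_inv (A R)) powr p)
    \<le> ln (op_norm (C ** M y) powr p) + op_norm (V y ** matrix_inv (A R)) powr p"
  using AE_inverse
proof eventually_elim
  case (elim y)
  have eq: "C ** matrix_inv (A R) = (C ** M y) ** (V y ** matrix_inv (A R))"
    using elim by (simp add: mult_mat_one)
  note l = ln_powr_op_norm_mult_le[OF eq C]
  have "ln (op_norm (V y ** matrix_inv (A R)) powr p) \<le> op_norm (V y ** matrix_inv (A R)) powr p"
    using ln_less_self[of "op_norm (V y ** matrix_inv (A R)) powr p"] l(2) by simp
  thus ?case using l(3) by linarith
qed

lemma integrable_lam_self:
  assumes R: "is_cube R"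
  shows "set_integrable lebesgue R (lam R)"
proof (rule set_integrable_bound)
  let ?g = "\<lambda>y. max 0 (ln (inner_avg p W R y)) + \<bar>ln c1\<bar> + op_norm (V y ** matrix_inv (A R)) powr p"
  show "set_integrable lebesgue R ?g"
    by (intro set_integral_add log_plus R integrable_VN integrable_const_lmeasurable cube_lmeasurable)
  show "set_borel_measurable lebesgue R (lam R)"
    by (intro set_borel_measurable_lebesgue cube_sets_lebesgue R lam_measurable)
  \<comment> \<open>With \<open>C = A R\<close> the left side of \<open>lam_lower\<close> is ln 1 =
    0, which bounds \<open>lam R\<close> from below; the integrable positive part bounds it from
    above.\<close>
  have o: "op_norm (A R ** matrix_inv (A R)) = 1" by (simp add: A_inverse[OF R])
  have "AE y in lebesgue. 0 \<le> lam R y + op_norm (V y ** matrix_inv (A R)) powr p"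
    using lam_lower[OF R, of "A R"] o by (simp add: lam_def)
  with AE_facts[OF R] show "AE y in lebesgue. y \<in> R \<longrightarrow> norm (lam R y) \<le> norm (?g y)"
  proof eventually_elim
    case (elim y)
    have "0 \<le> op_norm (V y ** matrix_inv (A R)) powr p" by simp
    moreover have "ln (inner_avg p W R y) \<le> max 0 (ln (inner_avg p W R y))"
      "0 \<le> max 0 (ln (inner_avg p W R y))" by simp_all
    ultimately have "\<bar>lam R y\<bar> \<le> ?g y" using elim by linarith
    thus ?case by simp
  qed
qed

lemma op_norm_AA_pos:
  assumes Q: "is_cube Q" and R: "is_cube R"
  shows "0 < op_norm (A Q ** matrix_inv (A R))"
proof -
  have "mat 1 = (A Q ** matrix_inv (A R)) ** (A R ** matrix_inv (A Q))"
    by (simp add: mult_mat_one A_inverse[OF R] A_inverse[OF Q])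
  from ln_powr_op_norm_mult_le(1)[OF this] show ?thesis by simp
qed

text \<open>Two applications of \<open>lam_shift\<close> show that \<open>lam Q\<close> and
  \<open>lam R\<close> differ by a bounded function. The hypothesis on the positive part concerns
  equal cubes; this extends it to arbitrary pairs.\<close>

lemma integrable_lam:
  assumes Q: "is_cube Q" and R: "is_cube R"
  shows "set_integrable lebesgue R (lam Q)"
proof (rule set_integrable_bound)
  let ?c = "\<bar>ln (op_norm (A Q ** matrix_inv (A R)) powr p)\<bar> + \<bar>ln (op_norm (A R ** matrix_inv (A Q)) powr p)\<bar>"
  let ?g = "\<lambda>y. \<bar>lam R y\<bar> + ?c"
  show "set_integrable lebesgue R ?g"
    by (intro set_integral_add(1) set_integrable_abs integrable_lam_self R integrable_const_lmeasurable cube_lmeasurable)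
  show "set_borel_measurable lebesgue R (lam Q)"
    by (intro set_borel_measurable_lebesgue cube_sets_lebesgue R lam_measurable)
  show "AE y in lebesgue. y \<in> R \<longrightarrow> norm (lam Q y) \<le> norm (?g y)"
    using lam_shift[OF Q R] lam_shift[OF R Q]
    by eventually_elim (auto simp: abs_if)
qed

lemma integrable_ln_inner_avg:
  assumes Q: "is_cube Q" and R: "is_cube R"
  shows "set_integrable lebesgue R (\<lambda>y. ln (inner_avg p W Q y))"
proof (rule set_integrable_bound)
  let ?g = "\<lambda>y. \<bar>lam Q y\<bar> + (\<bar>ln c1\<bar> + \<bar>ln c2\<bar>)"
  show "set_integrable lebesgue R ?g"
    by (intro set_integral_add(1) set_integrable_abs integrable_lam Q R integrable_const_lmeasurable cube_lmeasurable)
  have "(\<lambda>y. ln (inner_avg p W Q y)) \<in> borel_measurable lebesgue"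
    using inner_avg_measurable[OF Q] by measurable
  thus "set_borel_measurable lebesgue R (\<lambda>y. ln (inner_avg p W Q y))"
    by (intro set_borel_measurable_lebesgue cube_sets_lebesgue R)
  show "AE y in lebesgue. y \<in> R \<longrightarrow> norm (ln (inner_avg p W Q y)) \<le> norm (?g y)"
    using AE_facts[OF Q] by eventually_elim (auto simp: abs_if)
qed

section \<open>Equivalence of the geometric mean with norms of quotients of reducing
  operators\<close>

lemma avg_add_const:
  assumes "is_cube R" "set_integrable lebesgue R f"
  shows "avg R (\<lambda>y. c + f y) = c + avg R f"
  using assms by (simp add: avg_add avg_const cube_lmeasurable measure_cube_pos)

lemma integrable_add_const:
  assumes "is_cube R" "set_integrable lebesgue R f"
  shows "set_integrable lebesgue R (\<lambda>y. (c :: real) + f y)"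
  using assms by (intro set_integral_add integrable_const_lmeasurable cube_lmeasurable)

lemma log_mean_bounds:
  assumes Q: "is_cube Q" and R: "is_cube R"
  shows "c1 * exp (avg R (lam Q)) \<le> log_mean p W Q R" "log_mean p W Q R \<le> c2 * exp (avg R (lam Q))"
proof -
  note [intro] = integrable_add_const integrable_lam integrable_ln_inner_avg Q R
  have "avg R (\<lambda>y. ln c1 + lam Q y) \<le> avg R (\<lambda>y. ln (inner_avg p W Q y))"
    using AE_facts[OF Q] by (intro avg_mono_AE) auto
  hence "ln c1 + avg R (lam Q) \<le> avg R (\<lambda>y. ln (inner_avg p W Q y))"
    by (simp add: avg_add_const[OF R integrable_lam[OF Q R]])
  hence "exp (ln c1 + avg R (lam Q)) \<le> log_mean p W Q R" unfolding log_mean_def by simp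
  thus "c1 * exp (avg R (lam Q)) \<le> log_mean p W Q R" using c_pos by (simp add: exp_add)
  have "avg R (\<lambda>y. ln (inner_avg p W Q y)) \<le> avg R (\<lambda>y. ln c2 + lam Q y)"
    using AE_facts[OF Q] by (intro avg_mono_AE) auto
  hence "avg R (\<lambda>y. ln (inner_avg p W Q y)) \<le> ln c2 + avg R (lam Q)"
    by (simp add: avg_add_const[OF R integrable_lam[OF Q R]])
  hence "log_mean p W Q R \<le> exp (ln c2 + avg R (lam Q))" unfolding log_mean_def by simp
  thus "log_mean p W Q R \<le> c2 * exp (avg R (lam Q))" using c_pos by (simp add: exp_add)
qed

text \<open>The average of \<open>lam_lower\<close> over \<open>R\<close> has the error
  \<open>G R (matrix_inv (A R))\<close>. It is at most \<open>c2\<close>, since \<open>A R\<close>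
  times its inverse has norm 1; exponentiating gives the factor \<open>exp c2\<close>.\<close>

lemma op_norm_le_log_mean:
  assumes Q: "is_cube Q" and R: "is_cube R"
  shows "op_norm (A Q ** matrix_inv (A R)) powr p \<le> exp c2 / c1 * log_mean p W Q R"
proof -
  let ?t = "op_norm (A Q ** matrix_inv (A R)) powr p"
  have t: "0 < ?t" using op_norm_AA_pos[OF Q R] by simp
  note int = integrable_lam[OF Q R] integrable_VN[OF R, of "matrix_inv (A R)"]
  have "ln ?t = avg R (\<lambda>_. ln ?t)" by (simp add: avg_const cube_lmeasurable[OF R] measure_cube_pos[OF R])
  also have "\<dots> \<le> avg R (\<lambda>y. lam Q y + op_norm (V y ** matrix_inv (A R)) powr p)"
    using lam_lower[OF R op_norm_AA_pos[OF Q R]] unfolding lam_def[symmetric]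
    by (intro avg_mono_AE set_integral_add int integrable_const_lmeasurable cube_lmeasurable R)
  also have "\<dots> = avg R (lam Q) + G R (matrix_inv (A R))"
    by (simp add: avg_add[OF int] G_def)
  also have "G R (matrix_inv (A R)) \<le> c2"
    using G_upper[OF R, of "matrix_inv (A R)"] by (simp add: A_inverse[OF R])
  finally have "exp (ln ?t) \<le> exp (avg R (lam Q) + c2)" by simp
  hence "?t \<le> exp c2 * exp (avg R (lam Q))" by (simp only: exp_add exp_ln[OF t] mult.commute)
  also have "exp (avg R (lam Q)) \<le> log_mean p W Q R / c1"
    using log_mean_bounds(1)[OF Q R] c_pos by (simp add: field_simps)
  finally show ?thesis by (simp add: mult_left_mono)
qed

text \<open>The bound on the weight's characteristic enters the estimates in this form.\<close>

lemma exp_avg_lam_self_le: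
  assumes R: "is_cube R"
  shows "exp (avg R (lam R)) \<le> K / c1"
  using log_mean_bounds(1)[OF R R] K[OF R] c_pos by (simp add: field_simps)

text \<open>The converse comparison, at the price of \<open>K\<close>. It lets growth bounds for
  reducing operators yield dimensions of the weight.\<close>

lemma log_mean_le_op_norm:
  assumes Q: "is_cube Q" and R: "is_cube R"
  shows "log_mean p W Q R \<le> c2 * K / c1 * op_norm (A Q ** matrix_inv (A R)) powr p"
proof -
  let ?t = "op_norm (A Q ** matrix_inv (A R)) powr p"
  have t: "0 < ?t" using op_norm_AA_pos[OF Q R] by simp
  have "avg R (lam Q) \<le> avg R (\<lambda>y. ln ?t + lam R y)"
    by (intro avg_mono_AE integrable_lam integrable_add_const lam_shift Q R)
  also have "\<dots> = ln ?t + avg R (lam R)" by (rule avg_add_const[OF R integrable_lam[OF R R]])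
  finally have "exp (avg R (lam Q)) \<le> exp (ln ?t + avg R (lam R))" by simp
  also have "\<dots> = ?t * exp (avg R (lam R))" by (simp only: exp_add exp_ln[OF t])
  also have "\<dots> \<le> ?t * (K / c1)" by (intro mult_left_mono exp_avg_lam_self_le R) simp
  finally have "c2 * exp (avg R (lam Q)) \<le> c2 * (?t * (K / c1))" using c_pos by (intro mult_left_mono) auto
  with log_mean_bounds(2)[OF Q R] show ?thesis by (simp add: mult_ac)
qed

section \<open>Scalar weights and the existence of dimensions\<close>

lemma K_pos: "0 < K"
proof -
  have "is_cube (ccube (0 :: real ^ 'n) 1)" by (rule is_cube_ccube) simp
  from K[OF this] show ?thesis unfolding log_mean_def by (meson exp_gt_zero less_le_trans)
qed

text \<open>Since \<open>|A Q z| \<le> \<parallel>A Q M(y)\<parallel> |V(y) z|\<close>, the scalar weights \<open>w z\<close> inherit the exp-log condition.\<close>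

lemma scalar_weight_Ainf:
  assumes z: "z \<noteq> 0"
  shows "exp_log_Ainf (a powr (- p) * K / c1) (w z)"
proof -
  have "set_integrable lebesgue Q (\<lambda>x. ln (w z x)) \<and>
      avg Q (w z) \<le> a powr (- p) * K / c1 * exp (avg Q (\<lambda>x. ln (w z x)))" if Q: "is_cube Q" for Q
  proof -
    let ?t = "norm (A Q *v z) powr p"
    have "A Q *v z \<noteq> 0"
    proof
      assume "A Q *v z = 0"
      hence "(matrix_inv (A Q) ** A Q) *v z = 0" by (simp flip: matrix_vector_mul_assoc)
      thus False using z by (simp add: A_inverse[OF Q])
    qed
    hence nz: "0 < norm (A Q *v z)" by simp
    hence t: "0 < ?t" by simp
    have lo: "AE y in lebesgue. ln ?t - lam Q y \<le> ln (w z y)"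
      using AE_facts[OF Q] w_pos[OF z]
    proof eventually_elim
      case (elim y)
      have "A Q *v z = (A Q ** M y) *v (V y *v z)"
        using elim by (simp add: matrix_vector_mul_assoc flip: matrix_mul_assoc)
      hence "norm (A Q *v z) \<le> op_norm (A Q ** M y) * norm (V y *v z)" by (metis op_norm_bound)
      hence "?t \<le> (op_norm (A Q ** M y) * norm (V y *v z)) powr p" using p by (intro powr_mono2) auto
      also have "\<dots> = op_norm (A Q ** M y) powr p * w z y" by (simp add: powr_mult w_def)
      finally have "ln ?t \<le> ln (op_norm (A Q ** M y) powr p * w z y)" using t elim by (subst ln_le_cancel_iff) auto
      also have "\<dots> = lam Q y + ln (w z y)" unfolding lam_def using elim by (subst ln_mult_pos) auto
      finally show ?case by simp
    qed
    have up: "AE y in lebesgue. ln (w z y) \<le> w z y"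
      using w_pos[OF z] by eventually_elim (simp add: less_imp_le ln_less_self)
    have int: "set_integrable lebesgue Q (\<lambda>x. ln (w z x))"
    proof (rule set_integrable_bound)
      let ?g = "\<lambda>y. w z y + (\<bar>ln ?t\<bar> + \<bar>lam Q y\<bar>)"
      show "set_integrable lebesgue Q ?g"
        by (intro set_integral_add integrable_w integrable_const_lmeasurable cube_lmeasurable
            set_integrable_abs integrable_lam Q)
      have "(\<lambda>x. ln (w z x)) \<in> borel_measurable lebesgue" using w_measurable[of z] by measurable
      thus "set_borel_measurable lebesgue Q (\<lambda>x. ln (w z x))"
        by (intro set_borel_measurable_lebesgue cube_sets_lebesgue Q)
      show "AE y in lebesgue. y \<in> Q \<longrightarrow> norm (ln (w z y)) \<le> norm (?g y)"
        using lo up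
      proof eventually_elim
        case (elim y)
        thus ?case using w_nonneg[of z y] by (auto simp: abs_if)
      qed
    qed
    have "ln ?t = avg Q (\<lambda>_. ln ?t)" by (simp add: avg_const cube_lmeasurable[OF Q] measure_cube_pos[OF Q])
    also have "\<dots> \<le> avg Q (\<lambda>y. lam Q y + ln (w z y))"
    proof (rule avg_mono_AE)
      show "AE y in lebesgue. ln ?t \<le> lam Q y + ln (w z y)" using lo by eventually_elim simp
    qed (intro set_integral_add int integrable_lam Q integrable_const_lmeasurable cube_lmeasurable)+
    also have "\<dots> = avg Q (lam Q) + avg Q (\<lambda>y. ln (w z y))"
      by (rule avg_add[OF integrable_lam[OF Q Q] int])
    finally have "exp (ln ?t) \<le> exp (avg Q (lam Q) + avg Q (\<lambda>y. ln (w z y)))" by simp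
    hence "?t \<le> exp (avg Q (lam Q)) * exp (avg Q (\<lambda>y. ln (w z y)))" by (simp only: exp_add exp_ln[OF t])
    also have "\<dots> \<le> K / c1 * exp (avg Q (\<lambda>y. ln (w z y)))"
      by (intro mult_right_mono exp_avg_lam_self_le Q) simp
    finally have "a powr (- p) * ?t \<le> a powr (- p) * (K / c1 * exp (avg Q (\<lambda>y. ln (w z y))))"
      by (intro mult_left_mono) auto
    with avg_w_bounds(1)[OF Q, of z] int show ?thesis by (simp add: mult_ac)
  qed
  thus ?thesis unfolding exp_log_Ainf_def
    using w_measurable w_nonneg w_pos[OF z] integrable_w by blast
qed

text \<open>Reducing operators translate a comparison of scalar averages, uniform in the vector,
  into a bound for \<open>A Q ** matrix_inv (A R)\<close>: it is tested at the image of z under the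
  inverse of \<open>A R\<close>.\<close>

lemma log_mean_le_of_scalar:
  assumes Q: "is_cube Q" and R: "is_cube R" and D: "0 \<le> D"
    and le: "\<And>z. z \<noteq> 0 \<Longrightarrow> avg Q (w z) \<le> D * avg R (w z)"
  shows "log_mean p W Q R \<le> c2 * K / c1 * (b powr p * a powr (- p)) * D"
proof -
  have "op_norm (A Q ** matrix_inv (A R)) powr p \<le> b powr p * a powr (- p) * D"
  proof (rule op_norm_powr_leI[OF p])
    fix z
    let ?v = "matrix_inv (A R) *v z"
    have w0: "w 0 = (\<lambda>_. 0)" by (simp add: w_def[abs_def])
    \<comment> \<open>The scalar hypothesis is stated for nonzero vectors, where the weight is
      positive almost everywhere; at 0 both averages vanish.\<close>
    have le': "avg Q (w ?v) \<le> D * avg R (w ?v)"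
      using le[of ?v] by (cases "?v = 0") (simp_all add: w0 avg_def)
    have "norm ((A Q ** matrix_inv (A R)) *v z) powr p \<le> b powr p * avg Q (w ?v)"
      using avg_w_bounds(2)[OF Q, of ?v] by (simp add: matrix_vector_mul_assoc)
    also have "\<dots> \<le> b powr p * (D * (a powr (- p) * norm (A R *v ?v) powr p))"
      using le' avg_w_bounds(1)[OF R, of ?v] D by (meson mult_left_mono order_trans powr_ge_zero)
    also have "A R *v ?v = z" by (simp add: matrix_vector_mul_assoc A_inverse[OF R])
    finally show "norm ((A Q ** matrix_inv (A R)) *v z) powr p
      \<le> b powr p * a powr (- p) * D * norm z powr p" by (simp add: mult_ac)
  qed (use D in simp)
  hence "c2 * K / c1 * op_norm (A Q ** matrix_inv (A R)) powr p \<le> c2 * K / c1 * (b powr p * a powr (- p) * D)"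
    using c_pos K_pos by (intro mult_left_mono) auto
  with log_mean_le_op_norm[OF Q R] show ?thesis by (simp add: mult_ac)
qed

text \<open>The growth constants depend on the exp-log constant and the dimension n, hence hold for
  all scalar weights \<open>w z\<close> simultaneously.\<close>

lemma exists_lower_dim: "\<exists>d. 0 \<le> d \<and> d < real CARD('n) \<and> has_lower_dim p W d"
proof -
  have K': "0 < a powr (- p) * K / c1" using K_pos c_pos ab by simp
  obtain C d where C: "0 < C" "0 \<le> d" "d < real CARD('n)" and
    growth: "\<And>w (Q :: (real ^ 'n) set) R. exp_log_Ainf (a powr (- p) * K / c1) w \<Longrightarrow> is_cube Q \<Longrightarrow> is_cube R \<Longrightarrow>
      Q \<subseteq> R \<Longrightarrow> avg Q w \<le> C * (edge_length R / edge_length Q) powr d * avg R w"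
    using exp_log_Ainf_lower_growth[OF K', where 'n = 'n] by metis
  let ?C = "c2 * K / c1 * (b powr p * a powr (- p)) * C"
  have "log_mean p W Q R \<le> ?C * (edge_length R / edge_length Q) powr d"
    if "is_cube Q" "is_cube R" "Q \<subseteq> R" for Q R
    using log_mean_le_of_scalar[OF that(1,2), of "C * (edge_length R / edge_length Q) powr d"]
      growth[OF scalar_weight_Ainf that] C by (simp add: mult_ac)
  moreover have "0 < ?C" using c_pos K_pos ab C by simp
  ultimately have "has_lower_dim p W d" unfolding has_lower_dim_def by blast
  thus ?thesis using C by blast
qed

lemma exists_upper_dim: "\<exists>d. 0 \<le> d \<and> has_upper_dim p W d"
proof -
  have K': "0 < a powr (- p) * K / c1" using K_pos c_pos ab by simp
  obtain C d where C: "0 < C" "0 \<le> d" and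
    growth: "\<And>w (Q :: (real ^ 'n) set) s. exp_log_Ainf (a powr (- p) * K / c1) w \<Longrightarrow> is_cube Q \<Longrightarrow> 1 \<le> s \<Longrightarrow>
      avg (dilate s Q) w \<le> C * s powr d * avg Q w"
    using exp_log_Ainf_upper_growth[OF K', where 'n = 'n] by metis
  let ?C = "c2 * K / c1 * (b powr p * a powr (- p)) * C"
  have "log_mean p W (dilate s Q) Q \<le> ?C * s powr d" if "1 \<le> s" "is_cube Q" for s Q
  proof -
    have "is_cube (dilate s Q)"
      using dilate_cube_at[OF cube_at_params[OF that(2)], of s] that(1) unfolding is_cube_def by auto
    from log_mean_le_of_scalar[OF this that(2), of "C * s powr d"] growth[OF scalar_weight_Ainf that(2,1)] C
    show ?thesis by (simp add: mult_ac)
  qed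
  moreover have "0 < ?C" using c_pos K_pos ab C by simp
  ultimately have "has_upper_dim p W d" unfolding has_upper_dim_def by blast
  thus ?thesis using C by blast
qed

end

section \<open>The comparison estimate\<close>

lemma has_lower_dim_mono:
  assumes "has_lower_dim p W d" "d \<le> d'"
  shows "has_lower_dim p W d'"
proof -
  obtain C where C: "0 < C" "\<And>Q R. is_cube Q \<and> is_cube R \<and> Q \<subseteq> R \<Longrightarrow>
     log_mean p W Q R \<le> C * (edge_length R / edge_length Q) powr d"
    using assms(1) unfolding has_lower_dim_def by blast
  have "log_mean p W Q R \<le> C * (edge_length R / edge_length Q) powr d'"
    if QR: "is_cube Q \<and> is_cube R \<and> Q \<subseteq> R" for Q R
  proof -
    have "edge_length Q \<le> edge_length R"
      using cube_subset_coords(2) cube_at_params QR by metis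
    hence "1 \<le> edge_length R / edge_length Q" using edge_length_pos[of Q] QR by simp
    hence "(edge_length R / edge_length Q) powr d \<le> (edge_length R / edge_length Q) powr d'"
      using assms(2) by (intro powr_mono)
    thus ?thesis using C(1) C(2)[OF QR] by (meson mult_left_mono less_imp_le order_trans)
  qed
  thus ?thesis unfolding has_lower_dim_def using C(1) by blast
qed

lemma has_upper_dim_mono:
  assumes "has_upper_dim p W d" "d \<le> d'"
  shows "has_upper_dim p W d'"
proof -
  obtain C where C: "0 < C" "\<And>s Q. 1 \<le> s \<Longrightarrow> is_cube Q \<Longrightarrow> log_mean p W (dilate s Q) Q \<le> C * s powr d"
    using assms(1) unfolding has_upper_dim_def by blast
  have "log_mean p W (dilate s Q) Q \<le> C * s powr d'" if "1 \<le> s" "is_cube Q" for s Q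
  proof -
    have "s powr d \<le> s powr d'" using assms(2) that by (intro powr_mono)
    thus ?thesis using C(1) C(2)[OF that] by (meson mult_left_mono less_imp_le order_trans)
  qed
  thus ?thesis unfolding has_upper_dim_def using C(1) by blast
qed

lemma (in reduced_matrix_weight) lower_dim_range_imp:
  assumes "d \<in> lower_dim_range p W"
  shows "has_lower_dim p W d"
proof (cases "has_lower_dim p W (lower_dim p W)")
  case True
  thus ?thesis using assms has_lower_dim_mono unfolding lower_dim_range_def by auto
next
  case False
  hence "lower_dim p W < d" using assms by (simp add: lower_dim_range_def)
  \<comment> \<open>Nonemptiness ensures that some dimension lies below any number exceeding the
    infimum; the infimum of the empty set of reals would give no such information.\<close>
  moreover have "{d. 0 \<le> d \<and> d < real CARD('n) \<and> has_lower_dim p W d} \<noteq> {}"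
    using exists_lower_dim by blast
  ultimately obtain e where "has_lower_dim p W e" "e < d"
    unfolding lower_dim_def by (metis (mono_tags, lifting) cInf_lessD mem_Collect_eq)
  thus ?thesis using has_lower_dim_mono by fastforce
qed

lemma (in reduced_matrix_weight) upper_dim_range_imp:
  assumes "d \<in> upper_dim_range p W"
  shows "has_upper_dim p W d"
proof (cases "has_upper_dim p W (upper_dim p W)")
  case True
  thus ?thesis using assms has_upper_dim_mono unfolding upper_dim_range_def by auto
next
  case False
  hence "upper_dim p W < d" using assms by (simp add: upper_dim_range_def)
  moreover have "{d. 0 \<le> d \<and> has_upper_dim p W d} \<noteq> {}"
    using exists_upper_dim by blast
  ultimately obtain e where "has_upper_dim p W e" "e < d"
    unfolding upper_dim_def by (metis (mono_tags, lifting) cInf_lessD mem_Collect_eq)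
  thus ?thesis using has_upper_dim_mono by fastforce
qed

section \<open>Geometry of the enclosing cube and the final estimate\<close>

lemma subset_dilate:
  fixes Q R :: "(real ^ 'n) set"
  assumes Q: "is_cube Q" and R: "is_cube R" and s: "0 < s"
    and le: "2 * norm (cube_center Q - cube_center R) + edge_length Q < s * edge_length R"
  shows "Q \<subseteq> dilate s R"
proof
  fix x assume x: "x \<in> Q"
  have at: "cube_at (cube_center R) (s * edge_length R) (dilate s R)"
    by (rule dilate_cube_at[OF cube_at_params[OF R] s])
  have "x \<in> ccube (cube_center Q) (edge_length Q)"
    using x cube_at_null_diff(1)[OF cube_at_params[OF Q]] by blast
  hence x': "\<bar>x $ i - cube_center Q $ i\<bar> \<le> edge_length Q / 2" for i by (simp add: mem_ccube)
  \<comment> \<open>The strict inequality places x in the open cube, which is contained in the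
    dilate whatever faces it has.\<close>
  have "x $ i \<in> {cube_center R $ i - s * edge_length R / 2 <..< cube_center R $ i + s * edge_length R / 2}" for i
  proof -
    have "\<bar>cube_center Q $ i - cube_center R $ i\<bar> \<le> norm (cube_center Q - cube_center R)"
      using component_le_norm_cart[of "cube_center Q - cube_center R" i] by simp
    hence "\<bar>x $ i - cube_center R $ i\<bar> < s * edge_length R / 2" using x'[of i] le by linarith
    thus ?thesis unfolding greaterThanLessThan_iff by linarith
  qed
  thus "x \<in> dilate s R" using at unfolding cube_at_def by blast
qed

lemma (in reduced_matrix_weight) op_norm_AA_le:
  assumes d1: "has_lower_dim p W d1" and d2: "has_upper_dim p W d2"
  shows "\<exists>C>0. \<forall>Q R. is_cube Q \<and> is_cube R \<longrightarrow>
    op_norm (A Q ** matrix_inv (A R)) powr p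
      \<le> C * max ((edge_length R / edge_length Q) powr d1) ((edge_length Q / edge_length R) powr d2)
          * (1 + norm (cube_center Q - cube_center R) / max (edge_length Q) (edge_length R)) powr (d1 + d2)"
proof -
  obtain C1 where C1: "0 < C1" "\<And>Q R. is_cube Q \<Longrightarrow> is_cube R \<Longrightarrow> Q \<subseteq> R \<Longrightarrow>
     log_mean p W Q R \<le> C1 * (edge_length R / edge_length Q) powr d1"
    using d1 unfolding has_lower_dim_def by blast
  obtain C2 where C2: "0 < C2" "\<And>s Q. 1 \<le> s \<Longrightarrow> is_cube Q \<Longrightarrow> log_mean p W (dilate s Q) Q \<le> C2 * s powr d2"
    using d2 unfolding has_upper_dim_def by blast
  define e where "e = exp c2 / c1"
  have e: "0 < e" using c_pos by (simp add: e_def)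
  have main: "op_norm (A Q ** matrix_inv (A R)) powr p
      \<le> (e * C1 * (e * C2) * 3 powr (d1 + d2)) * max ((edge_length R / edge_length Q) powr d1) ((edge_length Q / edge_length R) powr d2)
          * (1 + norm (cube_center Q - cube_center R) / max (edge_length Q) (edge_length R)) powr (d1 + d2)"
    if Q: "is_cube Q" and R: "is_cube R" for Q R
  proof -
    define q r N where "q = edge_length Q" and "r = edge_length R" and "N = norm (cube_center Q - cube_center R)"
    define T where "T = 1 + N / max q r"
    \<comment> \<open>Chosen so that \<open>S\<close> has edge
      \<open>s * r = 3 * (max q r + N)\<close>. The factor 3 makes this strictly larger than
      \<open>2 * N + q\<close>, as \<open>subset_dilate\<close> requires, and at least
      \<open>r\<close>, so that s \<ge> 1.\<close>
    define s where "s = 3 * T * max q r / r"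
    have pos: "0 < q" "0 < r" "0 \<le> N" using Q R by (auto simp: q_def r_def N_def edge_length_pos)
    hence mx: "0 < max q r" "q \<le> max q r" "r \<le> max q r" by auto
    have T: "1 \<le> T" "T * max q r = max q r + N" using pos mx by (simp_all add: T_def field_simps)
    have sr: "s * r = 3 * (max q r + N)" using pos T(2) by (simp add: s_def)
    have lin: "r \<le> 3 * (m + N) \<and> 2 * N + q < 3 * (m + N)" if "0 < m" "q \<le> m" "r \<le> m" for m
      using that pos by argo
    have "r \<le> s * r" unfolding sr using lin[OF mx] by blast
    hence s: "1 \<le> s" using pos by simp
    define S where "S = dilate s R"
    have atS: "cube_at (cube_center R) (s * r) S"
      unfolding S_def r_def by (rule dilate_cube_at[OF cube_at_params[OF R]]) (use s in simp)
    hence S: "is_cube S" "edge_length S = s * r" by (auto simp: is_cube_def edge_length_eq)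
    have "2 * N + q < s * r" unfolding sr using lin[OF mx] by blast
    hence QS: "Q \<subseteq> S" unfolding S_def q_def r_def N_def using s by (intro subset_dilate Q R) auto
    have pm: "(3 * T * x) powr d = 3 powr d * T powr d * x powr d" if "0 \<le> x" for x d
      using that T(1) by (simp add: powr_mult)
    have "A Q ** matrix_inv (A R) = (A Q ** matrix_inv (A S)) ** (A S ** matrix_inv (A R))"
      by (simp add: mult_mat_one A_inverse[OF S(1)])
    hence "op_norm (A Q ** matrix_inv (A R)) powr p
      \<le> op_norm (A Q ** matrix_inv (A S)) powr p * op_norm (A S ** matrix_inv (A R)) powr p"
      using op_norm_mult_powr by simp
    also have "\<dots> \<le> (e * log_mean p W Q S) * (e * log_mean p W S R)"
      unfolding e_def by (intro mult_mono op_norm_le_log_mean Q R S)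
        (use c_pos in \<open>auto simp: log_mean_def\<close>)
    also have "\<dots> \<le> (e * (C1 * (s * r / q) powr d1)) * (e * (C2 * s powr d2))"
    proof (intro mult_mono mult_left_mono)
      show "log_mean p W Q S \<le> C1 * (s * r / q) powr d1" using C1(2)[OF Q S(1) QS] by (simp add: S(2) q_def)
      show "log_mean p W S R \<le> C2 * s powr d2" unfolding S_def by (rule C2(2)[OF s R])
    qed (use e C1(1) in \<open>auto simp: log_mean_def\<close>)
    also have "(s * r / q) powr d1 = 3 powr d1 * T powr d1 * (max q r / q) powr d1"
    proof -
      have "s * r / q = 3 * T * (max q r / q)" using pos by (simp add: s_def)
      thus ?thesis using pm[of "max q r / q"] pos mx by simp
    qed
    also have "s powr d2 = 3 powr d2 * T powr d2 * (max q r / r) powr d2"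
    proof -
      have "s = 3 * T * (max q r / r)" by (simp add: s_def)
      thus ?thesis using pm[of "max q r / r"] pos mx by simp
    qed
    also have "e * (C1 * (3 powr d1 * T powr d1 * (max q r / q) powr d1)) * (e * (C2 * (3 powr d2 * T powr d2 * (max q r / r) powr d2)))
      = (e * C1 * (e * C2) * 3 powr (d1 + d2)) * ((max q r / q) powr d1 * (max q r / r) powr d2) * T powr (d1 + d2)"
      by (simp add: powr_add mult_ac)
    also have "\<dots> \<le> (e * C1 * (e * C2) * 3 powr (d1 + d2)) * max ((r / q) powr d1) ((q / r) powr d2) * T powr (d1 + d2)"
    proof (intro mult_right_mono mult_left_mono)
      \<comment> \<open>One factor is always a power of 1: for q \<le> r the second, otherwise the
        first. The other is one of the two terms of the maximum.\<close>
      show "(max q r / q) powr d1 * (max q r / r) powr d2 \<le> max ((r / q) powr d1) ((q / r) powr d2)"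
        using pos by (cases "q \<le> r") (simp_all add: max_def)
    qed (use e C1(1) C2(1) in auto)
    finally show ?thesis by (simp add: q_def r_def T_def N_def)
  qed
  have "0 < e * C1 * (e * C2) * 3 powr (d1 + d2)" using e C1(1) C2(1) by simp
  thus ?thesis using main by blast
qed

theorem proposition6p5:
  fixes p d1 d2 :: real
    and W :: "real ^ 'n \<Rightarrow> complex ^ 'm ^ 'm"
    and A :: "(real ^ 'n) set \<Rightarrow> complex ^ 'm ^ 'm"
  assumes "0 < p"
    and "W \<in> Apinf p"
    and "reducing_operators p W A"
    and "d1 \<in> lower_dim_range p W"
    and "d2 \<in> upper_dim_range p W"
  shows "\<exists>C>0. \<forall>Q R. is_cube Q \<and> is_cube R \<longrightarrow>
    op_norm (A Q ** matrix_inv (A R)) powr p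
      \<le> C * max ((edge_length R / edge_length Q) powr d1) ((edge_length Q / edge_length R) powr d2)
          * (1 + norm (cube_center Q - cube_center R) / max (edge_length Q) (edge_length R)) powr (d1 + d2)"
proof -
  obtain a b where ab: "0 < a" "0 < b" and red: "\<And>Q. is_cube Q \<Longrightarrow>
     pos_definite (A Q) \<and>
     (\<forall>z. a * (avg Q (\<lambda>x. norm (mat_powr (W x) (1 / p) *v z) powr p)) powr (1 / p) \<le> norm (A Q *v z) \<and>
          norm (A Q *v z) \<le> b * (avg Q (\<lambda>x. norm (mat_powr (W x) (1 / p) *v z) powr p)) powr (1 / p))"
    using assms(3) unfolding reducing_operators_def by blast
  have fin: "Apinf_const p W < \<infinity>" using assms(2) by (simp add: Apinf_def)
  have K: "log_mean p W Q Q \<le> enn2real (Apinf_const p W)" if "is_cube Q" for Q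
  proof -
    have "ennreal (log_mean p W Q Q) \<le> Apinf_const p W"
      unfolding Apinf_const_def using that by (intro SUP_upper) simp
    \<comment> \<open>Finiteness matters here, since \<open>enn2real\<close> sends infinity to
      0.\<close>
    hence "enn2real (ennreal (log_mean p W Q Q)) \<le> enn2real (Apinf_const p W)"
      using fin by (intro enn2real_mono) auto
    thus ?thesis by (simp add: log_mean_def)
  qed
  interpret reduced_matrix_weight p a b "enn2real (Apinf_const p W)" W A
    by unfold_locales (use assms(1,2) ab red K in \<open>auto simp: Apinf_def\<close>)
  show ?thesis by (intro op_norm_AA_le lower_dim_range_imp upper_dim_range_imp assms)
qed

end
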